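(* Let $p\ge 5$ be a prime and let $u \geq 2$ be an integer. Then: (i) If $p-1 \mid 2u$ and $p \mid 2u-2$, then $$ \frac{\zeta(1-2u)}{2-2u}-\frac{1}{p}\cdot \frac{\zeta(1-2v)}{2-2v} + \frac{(p-1)^2}{2u \cdot p(2u+2p-2)} \equiv 0 \mod \mathbb{Z}_{(p)}, $$ where $v=\frac{u-1}{p}+1$. (ii) If $p-1 \nmid 2u$ and $p \mid 2u-2$, then $$ \frac{\zeta(1-2u)}{2-2u}-\frac{1}{p}\cdot \frac{\zeta(1-2v)}{2-2v} \equiv 0 \mod \mathbb{Z}_{(p)},$$ where $v=\frac{u-1}{p}+1$. (iii) If $p-1 \mid 2u$ and $p \nmid 2u-2$, then $$\frac{\zeta(1-2u)}{2-2u}+\frac{(p-1)^2}{2u \cdot p(2u+2p-2)}\equiv 0 \mod \mathbb{Z}_{(p)}.$$ (iv) If $p-1 \nmid 2u$ and $p \nmid 2u-2$, then $$\frac{\zeta(1-2u)}{2-2u} \equiv 0 \mod \mathbb{Z}_{(p)}.$$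
   Context: $\zeta$ is the Riemann zeta function; $\zeta(1-2k)=-\frac{B_{2k}}{2k}$ for $k\ge 1$, where $B_{2k}$ is the $2k$-th Bernoulli number. $\mathbb{Z}_{(p)}\subset\mathbb{Q}$ is the localization of $\mathbb{Z}$ at $p$; for rationals, $a\equiv b \mod \mathbb{Z}_{(p)}$ means $a-b\in\mathbb{Z}_{(p)}$. *)

theory Defs
  imports "HOL-Complex_Analysis.Complex_Analysis" "HOL-Computational_Algebra.Primes"
begin

definition is_riemann_zeta :: "(complex \<Rightarrow> complex) \<Rightarrow> bool" where
  "is_riemann_zeta f \<longleftrightarrow>
     f holomorphic_on (- {1}) \<and>
     (\<forall>s. Re s > 1 \<longrightarrow> (\<lambda>n. 1 / of_nat (Suc n) powr s) sums f s)"

(* By the identity theorem the predicate above determines f on - {1}; only the irrelevant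
   value at the pole s = 1 depends on the choice operator. *)
definition riemann_zeta :: "complex \<Rightarrow> complex" where
  "riemann_zeta = (SOME f. is_riemann_zeta f)"

lemma is_riemann_zeta_unique:
  assumes f: "is_riemann_zeta f" and g: "is_riemann_zeta g" and s: "s \<noteq> 1"
  shows "f s = g s"
proof (rule analytic_continuation_open[of "{s. Re s > 1}" "- {1}" f g])
  show "open {s. Re s > 1}" by (rule open_halfspace_Re_gt)
  have "2 \<in> {s. Re s > 1}" by simp
  then show "{s. Re s > 1} \<noteq> {}" by blast
  show "connected (- {1 :: complex})"
    by (rule connected_punctured_universe) simp
  show "f z = g z" if "z \<in> {s. Re s > 1}" for z
    using f g that unfolding is_riemann_zeta_def by (auto intro: sums_unique2)
qed (use f g s in \<open>auto simp: is_riemann_zeta_def\<close>)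

definition localization_at :: "int \<Rightarrow> rat set" where
  "localization_at p = {of_int a / of_int b | a b. \<not> p dvd b}"

(* The zeta values are complex numbers, so the ring is viewed inside the complex numbers via
   of_rat. In particular the congruence asserts that a - b is rational. *)
definition cong_mod_localization :: "complex \<Rightarrow> complex \<Rightarrow> int \<Rightarrow> bool" where
  "cong_mod_localization a b p \<longleftrightarrow> a - b \<in> of_rat ` localization_at p"

end

theory Submission
  imports Defs "HOL-Number_Theory.Residue_Primitive_Roots"
begin

text \<open>
  Put \<open>n = 2u\<close>. Since \<open>\<zeta>(1 - n) = - B\<^sub>n / n\<close>, everything is a statement on Bernoulli numbers; if
  \<open>p\<close> divides \<open>n - 2 = p d\<close>, then \<open>2v = d + 2\<close>, and the difference of the two zeta terms is
  \<open>(B\<^sub>n / n - B\<^sub>m / m) / (n - 2)\<close> with \<open>m = 2v\<close>.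

  For the zeta value, the Euler--Maclaurin tail \<open>- (1/a) \<Sum>\<^sub>k (a choose k) B\<^sub>k x\<^sup>a\<^sup>-\<^sup>k\<close>, \<open>a = 1 - s\<close>, of
  \<open>\<Sum> n\<^sup>-\<^sup>s\<close> is truncated at \<open>k = K\<close>: its increments agree with \<open>n\<^sup>-\<^sup>s\<close> up to
  \<open>O(n\<^sup>-\<^sup>s\<^sup>-\<^sup>K)\<close>, which continues zeta to \<open>Re s > 1 - K\<close>. At \<open>s = 1 - m\<close> the tail is the Bernoulli
  polynomial \<open>- B\<^sub>m(x) / m\<close> and the error vanishes.

  On the arithmetic side \<open>B\<^sub>n\<close> is the \<open>p\<close>-adic limit of the averages of \<open>x\<^sup>n\<close> over
  \<open>0 \<le> x < p\<^sup>N\<close>. If \<open>p - 1\<close> does not divide \<open>n\<close>, the permutation \<open>x \<mapsto> c x mod p\<^sup>N\<close> for a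
  primitive root \<open>c\<close> gives Voronoi's congruence, hence Kummer's. If \<open>n = (p - 1) k\<close>, write
  \<open>x\<^sup>p\<^sup>-\<^sup>1 = 1 + p w(x)\<close> for \<open>x\<close> prime to \<open>p\<close> and expand
  \<open>(x\<^sup>n - 1) / k = \<Sum>\<^sub>j (k - 1 choose j - 1) p\<^sup>j w(x)\<^sup>j / j\<close>: the averages of \<open>w\<^sup>j\<close> have denominator at
  most \<open>p\<^sup>2\<close>, and the term \<open>j = 1\<close> does not depend on \<open>k\<close>, so \<open>(B\<^sub>n - 1 + 1/p) / n\<close> is
  \<open>p\<close>-integral and satisfies the same congruences. The rational correction in (i) and (iii) is what the
  subtracted \<open>(1 - 1/p) / n\<close> contributes.
\<close>

section \<open>Bernoulli numbers\<close>

text \<open>Solves sum_{k <= n} (n+1 choose k) B_k = 0 for the last term, so the convention is B_1 =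
  -1/2.\<close>

fun bernoulli :: "nat \<Rightarrow> rat" where
  "bernoulli n = (if n = 0 then 1
     else - (\<Sum>k<n. of_nat (Suc n choose k) * bernoulli k) / of_nat (Suc n))"

declare bernoulli.simps [simp del]

lemma bernoulli_0 [simp]: "bernoulli 0 = 1"
  by (simp add: bernoulli.simps)

lemma sum_binomial_bernoulli:
  "(\<Sum>k<n. of_nat (n choose k) * bernoulli k) = (if n = 1 then 1 else 0)"
proof (cases "n \<ge> 2")
  case True
  then obtain m where m: "n = Suc m" "m > 0" by (cases n) auto
  show ?thesis using m by (simp add: bernoulli.simps[of m])
next
  case False
  then have "n = 0 \<or> n = 1" by auto
  then show ?thesis by auto
qed

definition bernpoly :: "nat \<Rightarrow> rat \<Rightarrow> rat" where
  "bernpoly n x = (\<Sum>k\<le>n. of_nat (n choose k) * bernoulli k * x ^ (n - k))"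

text \<open>Expanding the powers of \<open>x + 1\<close> and collecting by total order
  \<open>m\<close> turns the product of binomials into \<open>(n choose m) * (m choose k)\<close>.
  The inner sum over \<open>k \<le> m\<close> is then the Bernoulli recursion: it gives
  \<open>bernoulli m\<close> plus an extra 1 at \<open>m = 1\<close>, and that extra term is the
  right-hand side.\<close>

lemma bernpoly_add_1:
  assumes "n > 0"
  shows "bernpoly n (x + 1) - bernpoly n x = of_nat n * x ^ (n - 1)"
proof -
  have "bernpoly n (x + 1) = (\<Sum>k\<le>n. \<Sum>j\<le>n-k. of_nat (n choose k) * bernoulli k * (of_nat ((n-k) choose j) * x ^ j))"
    unfolding bernpoly_def by (simp add: binomial_ring sum_distrib_left)
  also have "\<dots> = (\<Sum>k\<le>n. \<Sum>m=k..n. of_nat (n choose k) * bernoulli k * (of_nat ((n-k) choose (n-m)) * x ^ (n-m)))"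
    by (intro sum.cong refl sum.reindex_bij_witness[of _ "\<lambda>m. n - m" "\<lambda>m. n - m"]) auto
  also have "\<dots> = (\<Sum>m\<le>n. \<Sum>k\<le>m. of_nat (n choose k) * bernoulli k * (of_nat ((n-k) choose (n-m)) * x ^ (n-m)))"
    by (subst (1 2) sum.Sigma) (auto intro!: sum.reindex_bij_witness[of _ "\<lambda>(a,b). (b,a)" "\<lambda>(a,b). (b,a)"])
  also have "\<dots> = (\<Sum>m\<le>n. of_nat (n choose m) * x ^ (n-m) * (\<Sum>k\<le>m. of_nat (m choose k) * bernoulli k))"
  proof (intro sum.cong refl)
    fix m assume "m \<in> {..n}"
    then have mn: "m \<le> n" by simp
    have "(n choose k) * ((n-k) choose (n-m)) = (n choose m) * (m choose k)" if "k \<le> m" for k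
      using choose_mult[of k m n] binomial_symmetric[of "n - m" "n - k"] that mn by (simp add: mult.commute)
    then have "of_nat (n choose k) * of_nat ((n-k) choose (n-m)) = (of_nat (n choose m) * of_nat (m choose k) :: rat)" if "k \<le> m" for k
      using that by (metis of_nat_mult)
    then show "(\<Sum>k\<le>m. of_nat (n choose k) * bernoulli k * (of_nat ((n-k) choose (n-m)) * x ^ (n-m)))
        = of_nat (n choose m) * x ^ (n-m) * (\<Sum>k\<le>m. of_nat (m choose k) * bernoulli k)"
      by (auto simp: sum_distrib_left mult_ac intro!: sum.cong)
  qed
  also have "\<dots> = (\<Sum>m\<le>n. of_nat (n choose m) * x ^ (n-m) * ((if m = 1 then 1 else 0) + bernoulli m))"
    by (intro sum.cong refl) (simp add: sum_binomial_bernoulli flip: lessThan_Suc_atMost)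
  also have "\<dots> = (\<Sum>m\<le>n. if m = 1 then of_nat n * x ^ (n-1) else 0) + bernpoly n x"
    unfolding bernpoly_def sum.distrib [symmetric]
    by (intro sum.cong refl) (simp add: ring_distribs mult_ac)
  also have "(\<Sum>m\<le>n. if m = 1 then of_nat n * x ^ (n-1) else 0) = of_nat n * x ^ (n-1)"
    using assms by (subst sum.delta) auto
  finally show ?thesis by simp
qed

text \<open>Telescopes \<open>bernpoly_add_1\<close> in degree \<open>n + 1\<close>; the constant
  term of the polynomial cancels, so the sum stops at \<open>k = n\<close>.\<close>

lemma sum_powers_bernoulli:
  "of_nat (n + 1) * (\<Sum>x<X. of_nat x ^ n) =
     (\<Sum>k\<le>n. of_nat (Suc n choose k) * bernoulli k * of_nat X ^ (Suc n - k))"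
proof -
  have "of_nat (n + 1) * (\<Sum>x<X. of_nat x ^ n) = bernpoly (Suc n) (of_nat X) - bernpoly (Suc n) 0"
  proof (induction X)
    case (Suc X)
    then show ?case using bernpoly_add_1[of "Suc n" "of_nat X"]
      by (simp add: ring_distribs add.commute)
  qed auto
  moreover have "bernpoly (Suc n) 0 = bernoulli (Suc n)"
    unfolding bernpoly_def by (subst sum.remove[of _ "Suc n"]) (auto intro!: sum.neutral)
  ultimately show ?thesis by (simp add: bernpoly_def)
qed

section \<open>Zeta values at negative integers\<close>

text \<open>The bound is the coefficient of t^j in (1 - t)^(-|b|), so the binomial series is
  majorized by one with nonnegative coefficients and known sum.\<close>

lemma norm_gbinomial_le:
  fixes b :: complex
  shows "norm (b gchoose j) \<le> (-1) ^ j * (- norm b gchoose j)"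
proof -
  have "norm (b gchoose j) = (\<Prod>i=0..<j. norm (b - of_nat i)) / fact j"
    by (simp add: gbinomial_prod_rev norm_divide prod_norm)
  also have "\<dots> \<le> (\<Prod>i=0..<j. norm b + of_nat i) / fact j"
    by (intro divide_right_mono prod_mono) (auto intro: order.trans[OF norm_triangle_ineq4])
  also have "\<dots> = (-1) ^ j * (- norm b gchoose j)"
    by (simp add: gbinomial_pochhammer pochhammer_prod mult.assoc[symmetric] flip: power_mult_distrib)
  finally show ?thesis .
qed

text \<open>The majorant at t = 1/2 sums to \<open>2 powr norm b\<close>. Writing |h|^j as (2|h|)^j
  (1/2)^j, the first factor of every tail term is at most (2|h|)^J because 2|h| <= 1.\<close>

lemma norm_binomial_remainder:
  fixes b h :: complex
  assumes h: "norm h \<le> 1 / 2"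
  shows "norm ((1 + h) powr b - (\<Sum>j<J. (b gchoose j) * h ^ j)) \<le> (2 * norm h) ^ J * 2 powr norm b"
proof -
  define c where "c j = (-1) ^ j * (- norm b gchoose j)" for j
  have c: "norm (b gchoose j) \<le> c j" for j using norm_gbinomial_le by (simp add: c_def)
  then have c0: "c j \<ge> 0" for j using norm_ge_zero order.trans by blast
  have "(\<lambda>j. (- norm b gchoose j) * (- 1 / 2) ^ j) sums (1 + (- 1 / 2)) powr (- norm b)"
    by (rule gen_binomial_real) simp
  also have "(\<lambda>j. (- norm b gchoose j) * (- 1 / 2) ^ j) = (\<lambda>j. c j * (1 / 2) ^ j)"
  proof
    fix j
    have "(- 1 / 2 :: real) ^ j = (-1) ^ j * (1 / 2) ^ j" by (simp flip: power_mult_distrib)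
    then show "(- norm b gchoose j) * (- 1 / 2) ^ j = c j * (1 / 2) ^ j" by (simp add: c_def)
  qed
  also have "(1 + (- 1 / 2)) powr (- norm b) = (2 powr norm b :: real)"
    by (simp add: powr_minus powr_divide)
  finally have csums: "(\<lambda>j. c j * (1 / 2) ^ j) sums (2 powr norm b)" .
  have bsums: "(\<lambda>j. (b gchoose j) * h ^ j) sums (1 + h) powr b"
    using h by (intro gen_binomial_complex) simp
  have tail: "(\<lambda>j. (b gchoose (j + J)) * h ^ (j + J)) sums ((1 + h) powr b - (\<Sum>j<J. (b gchoose j) * h ^ j))"
    using sums_split_initial_segment[OF bsums] .
  have le: "norm ((b gchoose (j + J)) * h ^ (j + J)) \<le> (2 * norm h) ^ J * (c (j + J) * (1 / 2) ^ (j + J))" for j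
  proof -
    have "(2 * norm h) ^ (j + J) \<le> (2 * norm h) ^ J"
      using h by (intro power_decreasing) auto
    have "norm ((b gchoose (j + J)) * h ^ (j + J)) \<le> c (j + J) * norm h ^ (j + J)"
      unfolding norm_mult norm_power by (intro mult_right_mono c) auto
    also have "\<dots> = (c (j + J) * (1 / 2) ^ (j + J)) * (2 * norm h) ^ (j + J)"
      by (simp add: power_mult_distrib power_divide)
    also have "\<dots> \<le> (c (j + J) * (1 / 2) ^ (j + J)) * (2 * norm h) ^ J"
      using c0 by (intro mult_left_mono \<open>(2 * norm h) ^ (j + J) \<le> (2 * norm h) ^ J\<close>) auto
    finally show ?thesis by (simp add: mult_ac)
  qed
  have summ: "summable (\<lambda>j. c (j + J) * (1 / 2) ^ (j + J))"
    using csums by (simp add: summable_iff_shift[of "\<lambda>j. c j * (1 / 2) ^ j"] sums_iff)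
  have "norm (\<Sum>j. (b gchoose (j + J)) * h ^ (j + J)) \<le> (\<Sum>j. (2 * norm h) ^ J * (c (j + J) * (1 / 2) ^ (j + J)))"
    using le summ by (intro norm_suminf_le summable_mult)
  also have "\<dots> = (2 * norm h) ^ J * (\<Sum>j. c (j + J) * (1 / 2) ^ (j + J))"
    using summ by (rule suminf_mult)
  also have "\<dots> \<le> (2 * norm h) ^ J * 2 powr norm b"
  proof (intro mult_left_mono)
    have "(\<Sum>j. c j * (1 / 2) ^ j) = (\<Sum>j. c (j + J) * (1 / 2) ^ (j + J)) + (\<Sum>j<J. c j * (1 / 2) ^ j)"
      using csums by (intro suminf_split_initial_segment) (simp add: sums_iff)
    moreover have "(\<Sum>j<J. c j * (1 / 2) ^ j) \<ge> 0" using c0 by (intro sum_nonneg) auto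
    ultimately show "(\<Sum>j. c (j + J) * (1 / 2) ^ (j + J)) \<le> 2 powr norm b"
      using csums by (simp add: sums_iff)
  qed auto
  finally show ?thesis using tail by (simp add: sums_iff)
qed

text \<open>
  The Bernoulli polynomial \<open>B\<^sub>a(x)\<close> of complex degree \<open>a\<close>, an asymptotic expansion in \<open>x\<close>, truncated
  at \<open>K\<close>; it satisfies \<open>B\<^sub>a(x + 1) - B\<^sub>a(x) = a x\<^sup>a\<^sup>-\<^sup>1\<close> only up to \<open>O(x\<^sup>a\<^sup>-\<^sup>K\<^sup>-\<^sup>1)\<close>.
\<close>
definition bern_series :: "nat \<Rightarrow> complex \<Rightarrow> complex \<Rightarrow> complex" where
  "bern_series K a x = (\<Sum>k\<le>K. (a gchoose k) * of_rat (bernoulli k) * x powr (a - of_nat k))"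

text \<open>Collects the binomial remainder bounds of the terms of \<open>bern_series\<close>, the
  \<open>k\<close>-th one expanded to \<open>K + 1 - k\<close> terms. The explicit form is
  continuous in \<open>a\<close>, which yields bounds uniform on compact sets.\<close>

definition bern_series_const :: "nat \<Rightarrow> complex \<Rightarrow> real" where
  "bern_series_const K a = (\<Sum>k\<le>K. norm ((a gchoose k) * of_rat (bernoulli k)) * (2 ^ (K + 1 - k) * 2 powr norm (a - of_nat k)))"

lemma bern_series_const_nonneg: "bern_series_const K a \<ge> 0"
  unfolding bern_series_const_def by (intro sum_nonneg) auto

text \<open>The computation of \<open>bernpoly_add_1\<close> with generalized binomials: the
  truncations are arranged so that exactly the total orders \<open>k + j \<le> K\<close> survive,
  and each of them is a complete Bernoulli recursion.\<close>

lemma bern_series_main_terms: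
  fixes x a :: complex
  assumes "K > 0" "x \<noteq> 0"
  shows "(\<Sum>k\<le>K. (a gchoose k) * of_rat (bernoulli k) * x powr (a - of_nat k) *
            (\<Sum>j<K + 1 - k. (a - of_nat k gchoose j) * (1 / x) ^ j)) = bern_series K a x + a * x powr (a - 1)"
proof -
  let ?B = "\<lambda>k. of_rat (bernoulli k) :: complex"
  have "(\<Sum>k\<le>K. (a gchoose k) * ?B k * x powr (a - of_nat k) *
            (\<Sum>j<K + 1 - k. (a - of_nat k gchoose j) * (1 / x) ^ j)) =
        (\<Sum>k\<le>K. \<Sum>j<K + 1 - k. (a gchoose k) * ?B k * x powr (a - of_nat k) * ((a - of_nat k gchoose j) * (1 / x) ^ j))"
    by (simp add: sum_distrib_left)
  also have "\<dots> = (\<Sum>k\<le>K. \<Sum>m=k..K. (a gchoose k) * ?B k * x powr (a - of_nat k) * ((a - of_nat k gchoose (m - k)) * (1 / x) ^ (m - k)))"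
  proof (rule sum.cong[OF refl])
    fix k
    show "(\<Sum>j<K + 1 - k. (a gchoose k) * ?B k * x powr (a - of_nat k) * ((a - of_nat k gchoose j) * (1 / x) ^ j)) =
      (\<Sum>m=k..K. (a gchoose k) * ?B k * x powr (a - of_nat k) * ((a - of_nat k gchoose (m - k)) * (1 / x) ^ (m - k)))"
      by (rule sum.reindex_bij_witness[of _ "\<lambda>m. m - k" "\<lambda>j. j + k"]) auto
  qed
  also have "\<dots> = (\<Sum>m\<le>K. \<Sum>k\<le>m. (a gchoose k) * ?B k * x powr (a - of_nat k) * ((a - of_nat k gchoose (m - k)) * (1 / x) ^ (m - k)))"
    by (subst (1 2) sum.Sigma) (auto intro!: sum.reindex_bij_witness[of _ "\<lambda>(a,b). (b,a)" "\<lambda>(a,b). (b,a)"])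
  also have "\<dots> = (\<Sum>m\<le>K. (a gchoose m) * x powr (a - of_nat m) * (\<Sum>k\<le>m. of_nat (m choose k) * ?B k))"
    unfolding sum_distrib_left
  proof (intro sum.cong refl)
    fix m k :: nat assume "k \<in> {..m}"
    then have k: "k \<le> m" by simp
    have rearrange: "e * B * X * (f * Y) = c * W * (d * B)" if "c * d = e * f" "X * Y = W" for B c d e f W X Y :: complex
    proof -
      have "e * B * X * (f * Y) = (e * f) * B * (X * Y)" by (simp only: mult_ac)
      also have "\<dots> = c * W * (d * B)" by (simp only: that(2)) (simp only: that(1)[symmetric] mult_ac)
      finally show ?thesis .
    qed
    have "(a gchoose m) * of_nat (m choose k) = (a gchoose k) * (a - of_nat k gchoose (m - k))"
      using gbinomial_trinomial_revision[OF k, of a] by (simp add: binomial_gbinomial)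
    moreover have "x powr (a - of_nat k) * (1 / x) ^ (m - k) = x powr (a - of_nat m)"
    proof -
      have "x powr (a - of_nat k) = x powr (a - of_nat m) * x powr of_nat (m - k)"
        using k by (simp add: of_nat_diff flip: powr_add)
      then show ?thesis using assms by (simp add: powr_nat power_divide)
    qed
    ultimately show "(a gchoose k) * ?B k * x powr (a - of_nat k) * ((a - of_nat k gchoose (m - k)) * (1 / x) ^ (m - k))
      = (a gchoose m) * x powr (a - of_nat m) * (of_nat (m choose k) * ?B k)"
      by (rule rearrange)
  qed
  also have "\<dots> = (\<Sum>m\<le>K. (a gchoose m) * x powr (a - of_nat m) * ((if m = 1 then 1 else 0) + ?B m))"
  proof (intro sum.cong refl)
    fix m
    have "(\<Sum>k\<le>m. of_nat (m choose k) * ?B k) = of_rat (\<Sum>k\<le>m. of_nat (m choose k) * bernoulli k)"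
      by (simp add: of_rat_sum of_rat_mult)
    also have "(\<Sum>k\<le>m. of_nat (m choose k) * bernoulli k) = (if m = 1 then 1 else 0) + bernoulli m"
      by (simp add: sum_binomial_bernoulli flip: lessThan_Suc_atMost)
    finally show "(a gchoose m) * x powr (a - of_nat m) * (\<Sum>k\<le>m. of_nat (m choose k) * ?B k) =
      (a gchoose m) * x powr (a - of_nat m) * ((if m = 1 then 1 else 0) + ?B m)"
      by (simp add: of_rat_add)
  qed
  also have "\<dots> = (\<Sum>m\<le>K. (if m = 1 then a * x powr (a - 1) else 0) + (a gchoose m) * ?B m * x powr (a - of_nat m))"
    by (intro sum.cong refl) (simp add: ring_distribs mult_ac)
  also have "\<dots> = (\<Sum>m\<le>K. if m = 1 then a * x powr (a - 1) else 0) + bern_series K a x"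
    by (simp add: sum.distrib bern_series_def)
  also have "(\<Sum>m\<le>K. if m = 1 then a * x powr (a - 1) else 0) = a * x powr (a - 1)"
    using assms by (subst sum.delta) auto
  finally show ?thesis by simp
qed

text \<open>Factor (n+1)^b as n^b (1 + 1/n)^b and expand the second factor. Cutting the
  \<open>k\<close>-th term after \<open>K + 1 - k\<close> summands makes all remainders of the same
  order n^(a-K-1); \<open>n \<ge> 2\<close> keeps 1/n within the range of the binomial
  estimate.\<close>

lemma norm_bern_series_difference:
  fixes a :: complex
  assumes K: "K > 0" and n: "n \<ge> 2"
  shows "norm (bern_series K a (of_nat (Suc n)) - bern_series K a (of_nat n) - a * of_nat n powr (a - 1)) \<le>
     bern_series_const K a * real n powr (Re a - real K - 1)"
proof -
  define x h :: complex where "x = of_nat n" and "h = 1 / x"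
  have x: "x \<noteq> 0" "x = of_real (real n)" "norm h = 1 / real n" "norm h \<le> 1 / 2"
    using n by (auto simp: x_def h_def norm_divide field_simps)
  let ?c = "\<lambda>k. (a gchoose k) * of_rat (bernoulli k)"
  let ?R = "\<lambda>k. (1 + h) powr (a - of_nat k) - (\<Sum>j<K + 1 - k. (a - of_nat k gchoose j) * h ^ j)"
  have "of_nat (Suc n) powr b = x powr b * (1 + h) powr b" for b
  proof -
    have "of_nat (Suc n) = (of_real (real n) * of_real (1 + 1 / real n) :: complex)"
      using n by (simp add: field_simps)
    \<comment> \<open>Both factors are nonnegative reals, so the complex power is multiplicative
      here without a branch correction.\<close>
    also have "\<dots> powr b = of_real (real n) powr b * of_real (1 + 1 / real n) powr b"
      by (rule powr_times_real) auto
    finally show ?thesis by (simp add: x_def h_def)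
  qed
  then have "bern_series K a (of_nat (Suc n)) = (\<Sum>k\<le>K. ?c k * x powr (a - of_nat k) * (1 + h) powr (a - of_nat k))"
    unfolding bern_series_def by (simp add: mult_ac)
  also have "\<dots> = (\<Sum>k\<le>K. ?c k * x powr (a - of_nat k) * ?R k) +
      (\<Sum>k\<le>K. ?c k * x powr (a - of_nat k) * (\<Sum>j<K + 1 - k. (a - of_nat k gchoose j) * h ^ j))"
    unfolding sum.distrib[symmetric] by (intro sum.cong refl) (simp add: algebra_simps)
  also have "(\<Sum>k\<le>K. ?c k * x powr (a - of_nat k) * (\<Sum>j<K + 1 - k. (a - of_nat k gchoose j) * h ^ j)) =
      bern_series K a x + a * x powr (a - 1)"
    unfolding h_def by (rule bern_series_main_terms[OF K x(1)])
  finally have "norm (bern_series K a (of_nat (Suc n)) - bern_series K a x - a * x powr (a - 1)) =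
     norm (\<Sum>k\<le>K. ?c k * x powr (a - of_nat k) * ?R k)"
    by simp
  also have "\<dots> \<le> (\<Sum>k\<le>K. norm (?c k) * (2 ^ (K + 1 - k) * 2 powr norm (a - of_nat k)) * real n powr (Re a - real K - 1))"
  proof (rule sum_norm_le)
    fix k assume "k \<in> {..K}"
    then have k: "k \<le> K" by simp
    have "norm (?c k * x powr (a - of_nat k) * ?R k) = norm (?c k) * (norm (x powr (a - of_nat k)) * norm (?R k))"
      by (simp only: norm_mult mult.assoc)
    also have "\<dots> \<le> norm (?c k) * (real n powr (Re a - real k) * ((2 * norm h) ^ (K + 1 - k) * 2 powr norm (a - of_nat k)))"
      using n unfolding x(2) by (intro mult_left_mono mult_mono norm_binomial_remainder x) (auto simp: norm_powr_real_powr)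
    also have "real n powr (Re a - real k) * ((2 * norm h) ^ (K + 1 - k) * 2 powr norm (a - of_nat k)) =
       (2 ^ (K + 1 - k) * 2 powr norm (a - of_nat k)) * (real n powr (Re a - real k) * (1 / real n) ^ (K + 1 - k))"
      by (simp add: x(3) power_mult_distrib power_divide)
    also have "real n powr (Re a - real k) * (1 / real n) ^ (K + 1 - k) = real n powr (Re a - real K - 1)"
    proof -
      have "real n powr (Re a - real k) = real n powr (Re a - real K - 1) * real n powr real (K + 1 - k)"
        using k by (simp add: of_nat_diff flip: powr_add)
      then show ?thesis using n by (simp add: powr_realpow power_divide)
    qed
    finally show "norm (?c k * x powr (a - of_nat k) * ?R k) \<le>
       norm (?c k) * (2 ^ (K + 1 - k) * 2 powr norm (a - of_nat k)) * real n powr (Re a - real K - 1)"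
      by (simp add: mult_ac)
  qed
  also have "\<dots> = bern_series_const K a * real n powr (Re a - real K - 1)"
    unfolding bern_series_const_def sum_distrib_right ..
  finally show ?thesis by (simp add: x_def)
qed

section \<open>Analytic continuation of the Dirichlet series\<close>

definition zeta_term :: "nat \<Rightarrow> nat \<Rightarrow> complex \<Rightarrow> complex" where
  "zeta_term K n s = 1 / of_nat (Suc n) powr s -
     (bern_series K (1 - s) (of_nat (Suc (Suc n))) - bern_series K (1 - s) (of_nat (Suc n))) / (1 - s)"

text \<open>For \<open>Re s > 1\<close> the increments subtracted in \<open>zeta_term\<close>
  telescope to \<open>- bern_series K (1 - s) 1 / (1 - s)\<close>; adding this value back restores
  the Dirichlet series.\<close>

definition zeta_approx :: "nat \<Rightarrow> complex \<Rightarrow> complex" where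
  "zeta_approx K s = (\<Sum>n. zeta_term K n s) - bern_series K (1 - s) 1 / (1 - s)"

text \<open>The half-plane where the error n^(-s-K) is absolutely summable, without the
  pole.\<close>

definition zeta_domain :: "nat \<Rightarrow> complex set" where
  "zeta_domain K = {s. Re s > 1 - real K} - {1}"

lemma open_zeta_domain: "open (zeta_domain K)"
  unfolding zeta_domain_def by (intro open_delete open_halfspace_Re_gt)

lemma connected_zeta_domain: "connected (zeta_domain K)"
  unfolding zeta_domain_def
  by (intro connected_open_delete open_halfspace_Re_gt convex_connected convex_halfspace_Re_gt) simp

lemma holomorphic_bern_series:
  assumes "x \<noteq> 0"
  shows "(\<lambda>s. bern_series K (1 - s) x) holomorphic_on A"
  unfolding bern_series_def gbinomial_prod_rev using assms by (intro holomorphic_intros) auto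

lemma holomorphic_zeta_term: "zeta_term K n holomorphic_on - {1}"
proof -
  have "of_nat (Suc n) \<noteq> (0 :: complex)" "of_nat (Suc (Suc n)) \<noteq> (0 :: complex)"
    by (simp_all only: of_nat_eq_0_iff)
  then show ?thesis unfolding zeta_term_def
    by (intro holomorphic_intros holomorphic_bern_series) auto
qed

lemma norm_zeta_term:
  assumes "K > 0" "n > 0" "s \<noteq> 1"
  shows "norm (zeta_term K n s) \<le> bern_series_const K (1 - s) / norm (1 - s) * real (Suc n) powr (- Re s - real K)"
proof -
  have s: "1 - s \<noteq> 0" using assms by simp
  have "zeta_term K n s = - (bern_series K (1 - s) (of_nat (Suc (Suc n))) - bern_series K (1 - s) (of_nat (Suc n)) -
      (1 - s) * of_nat (Suc n) powr (1 - s - 1)) / (1 - s)"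
    unfolding zeta_term_def using s by (simp add: powr_minus field_simps)
  then have "norm (zeta_term K n s) = norm (bern_series K (1 - s) (of_nat (Suc (Suc n))) - bern_series K (1 - s) (of_nat (Suc n)) -
      (1 - s) * of_nat (Suc n) powr (1 - s - 1)) / norm (1 - s)"
    by (simp add: norm_divide norm_minus_commute)
  also have "\<dots> \<le> bern_series_const K (1 - s) * real (Suc n) powr (Re (1 - s) - real K - 1) / norm (1 - s)"
    using assms by (intro divide_right_mono norm_bern_series_difference) auto
  finally show ?thesis by simp
qed

lemma continuous_bern_series_const:
  "1 \<notin> A \<Longrightarrow> continuous_on A (\<lambda>s. bern_series_const K (1 - s) / norm (1 - s))"
  unfolding bern_series_const_def gbinomial_prod_rev by (intro continuous_intros) auto

lemma uniform_limit_zeta_term: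
  assumes K: "K > 0" and A: "compact A" "A \<subseteq> zeta_domain K"
  shows "uniform_limit A (\<lambda>N s. \<Sum>n<N. zeta_term K n s) (\<lambda>s. \<Sum>n. zeta_term K n s) sequentially"
proof (cases "A = {}")
  case False
  have "1 \<notin> A" using A by (auto simp: zeta_domain_def)
  then have "compact ((\<lambda>s. bern_series_const K (1 - s) / norm (1 - s)) ` A)"
    by (intro compact_continuous_image continuous_bern_series_const A)
  then obtain M where M: "\<And>s. s \<in> A \<Longrightarrow> bern_series_const K (1 - s) / norm (1 - s) \<le> M"
    by (meson bounded_imp_bdd_above compact_imp_bounded bdd_above.E imageI)
  have "continuous_on A Re" by (intro continuous_intros)
  then obtain t where t: "t \<in> A" "\<And>s. s \<in> A \<Longrightarrow> Re t \<le> Re s"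
    using continuous_attains_inf[OF A(1) False] by blast
  define \<sigma> where "\<sigma> = - Re t - real K"
  have \<sigma>: "\<sigma> < -1" using t A by (auto simp: \<sigma>_def zeta_domain_def)
  show ?thesis
  \<comment> \<open>The estimate of \<open>zeta_term\<close> is available only for
    \<open>n > 0\<close>, hence the eventual form of the test. \<open>M\<close> bounds the
    continuous constant on \<open>A\<close>, and the leftmost point \<open>t\<close> gives the
    largest exponent.\<close>
  proof (rule Weierstrass_m_test_ev)
    show "\<forall>\<^sub>F n in sequentially. \<forall>s\<in>A. norm (zeta_term K n s) \<le> M * real (Suc n) powr \<sigma>"
      using eventually_gt_at_top[of 0]
    proof eventually_elim
      case (elim n)
      show ?case
      proof
        fix s assume s: "s \<in> A"
        have "norm (zeta_term K n s) \<le> bern_series_const K (1 - s) / norm (1 - s) * real (Suc n) powr (- Re s - real K)"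
          using s \<open>1 \<notin> A\<close> by (intro norm_zeta_term K elim) auto
        also have "\<dots> \<le> M * real (Suc n) powr \<sigma>"
        proof (intro mult_mono powr_mono)
          have "0 \<le> bern_series_const K (1 - s) / norm (1 - s)"
            using bern_series_const_nonneg[of K "1 - s"] by simp
          also note M[OF s]
          finally show "0 \<le> M" .
        qed (use M[OF s] t(2)[OF s] in \<open>auto simp: \<sigma>_def\<close>)
        finally show "norm (zeta_term K n s) \<le> M * real (Suc n) powr \<sigma>" .
      qed
    qed
    show "summable (\<lambda>n. M * real (Suc n) powr \<sigma>)"
      using \<sigma> by (intro summable_mult) (simp add: summable_Suc_iff[of "\<lambda>n. real n powr \<sigma>"] summable_real_powr_iff del: of_nat_Suc)
  qed
qed simp

lemma holomorphic_zeta_approx: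
  assumes K: "K > 0"
  shows "zeta_approx K holomorphic_on zeta_domain K"
proof -
  have "(\<lambda>s. \<Sum>n. zeta_term K n s) holomorphic_on zeta_domain K"
  proof (rule holomorphic_uniform_sequence[OF open_zeta_domain])
    show "(\<lambda>s. \<Sum>n<N. zeta_term K n s) holomorphic_on zeta_domain K" for N
      by (intro holomorphic_intros holomorphic_on_subset[OF holomorphic_zeta_term]) (auto simp: zeta_domain_def)
    fix s assume "s \<in> zeta_domain K"
    then obtain d where "d > 0" "cball s d \<subseteq> zeta_domain K"
      using open_zeta_domain open_contains_cball by blast
    then show "\<exists>d>0. cball s d \<subseteq> zeta_domain K \<and>
      uniform_limit (cball s d) (\<lambda>N s. \<Sum>n<N. zeta_term K n s) (\<lambda>s. \<Sum>n. zeta_term K n s) sequentially"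
      using uniform_limit_zeta_term[OF K compact_cball] by blast
  qed
  moreover have "(\<lambda>s. bern_series K (1 - s) 1 / (1 - s)) holomorphic_on zeta_domain K"
    by (intro holomorphic_intros holomorphic_bern_series) (auto simp: zeta_domain_def)
  ultimately show ?thesis
    unfolding zeta_approx_def by (rule holomorphic_on_diff)
qed

lemma zeta_term_sums:
  assumes "K > 0" "s \<in> zeta_domain K"
  shows "(\<lambda>n. zeta_term K n s) sums (\<Sum>n. zeta_term K n s)"
  using uniform_limit_zeta_term[of K "{s}"] assms
  by (auto simp: sums_def dest: tendsto_uniform_limitI)

lemma zeta_approx_sums:
  assumes K: "K > 0" and s: "Re s > 1"
  shows "(\<lambda>n. 1 / of_nat (Suc n) powr s) sums zeta_approx K s"
proof -
  let ?S = "\<lambda>n. bern_series K (1 - s) (of_nat (Suc n))"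
  have dom: "s \<in> zeta_domain K" using s by (auto simp: zeta_domain_def)
  have "?S \<longlonglongrightarrow> (\<Sum>k\<le>K. (1 - s gchoose k) * of_rat (bernoulli k) * 0)"
    unfolding bern_series_def using s
    by (intro tendsto_intros tendsto_neg_powr_complex_of_nat filterlim_Suc) auto
  then have lim: "?S \<longlonglongrightarrow> 0" by simp
  have "(\<lambda>n. (?S (Suc n) - ?S n) / (1 - s)) sums ((0 - ?S 0) / (1 - s))"
    by (intro sums_divide telescope_sums lim)
  from sums_add[OF zeta_term_sums[OF K dom] this] show ?thesis
    by (simp add: zeta_term_def zeta_approx_def)
qed

lemma zeta_approx_eq:
  assumes "K > 0" "s \<in> zeta_domain K" "L > 0" "s \<in> zeta_domain L"
  shows "zeta_approx K s = zeta_approx L s"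
proof -
  define m where "m = min K L"
  have m: "zeta_domain m \<subseteq> zeta_domain K" "zeta_domain m \<subseteq> zeta_domain L" "s \<in> zeta_domain m"
    using assms by (auto simp: zeta_domain_def m_def min_def)
  show ?thesis
  proof (rule analytic_continuation_open[of "{s. Re s > 1}" "zeta_domain m" "zeta_approx K" "zeta_approx L"])
    show "open {s. Re s > 1}" by (rule open_halfspace_Re_gt)
    have "2 \<in> {s. Re s > 1}" by simp
    then show "{s. Re s > 1} \<noteq> {}" by blast
    show "{s. Re s > 1} \<subseteq> zeta_domain m" by (auto simp: zeta_domain_def)
    show "zeta_approx K z = zeta_approx L z" if "z \<in> {s. Re s > 1}" for z
      using that zeta_approx_sums assms by (blast intro: sums_unique2)
    show "zeta_approx K holomorphic_on zeta_domain m" "zeta_approx L holomorphic_on zeta_domain m"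
      using m assms by (blast intro: holomorphic_on_subset holomorphic_zeta_approx)+
  qed (fact m open_zeta_domain connected_zeta_domain)+
qed

text \<open>Existence is what makes the choice operator meaningful. The approximations agree on
  overlapping half-planes by the identity theorem, so picking a large enough \<open>K\<close>
  separately at each point glues them to one function on the punctured plane.\<close>

lemma is_riemann_zeta_riemann_zeta: "is_riemann_zeta riemann_zeta"
proof -
  define K where "K s = Suc (nat \<lceil>1 - Re s\<rceil>)" for s
  have K: "K s > 0" "s \<noteq> 1 \<Longrightarrow> s \<in> zeta_domain (K s)" for s
  proof -
    have "1 - real (K s) < Re s" unfolding K_def by linarith
    then show "s \<noteq> 1 \<Longrightarrow> s \<in> zeta_domain (K s)" by (simp add: zeta_domain_def)
  qed (simp add: K_def)
  define f where "f s = zeta_approx (K s) s" for s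
  have f: "f s = zeta_approx L s" if "L > 0" "s \<in> zeta_domain L" for s L
  proof -
    have "s \<noteq> 1" using that by (simp add: zeta_domain_def)
    then show ?thesis unfolding f_def by (intro zeta_approx_eq K that)
  qed
  have "f holomorphic_on (\<Union>L\<in>{0<..}. zeta_domain L)"
    using holomorphic_zeta_approx f open_zeta_domain
    by (intro holomorphic_on_UN_open) (auto cong: holomorphic_cong)
  also have "(\<Union>L\<in>{0<..}. zeta_domain L) = - {1}"
    using K by (auto simp: zeta_domain_def)
  finally have "f holomorphic_on - {1}" .
  moreover have "(\<lambda>n. 1 / of_nat (Suc n) powr s) sums f s" if "Re s > 1" for s
    unfolding f_def using that by (intro zeta_approx_sums K)
  ultimately have "is_riemann_zeta f" unfolding is_riemann_zeta_def by blast
  then show ?thesis unfolding riemann_zeta_def by (rule someI[of is_riemann_zeta])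
qed

lemma riemann_zeta_eq_zeta_approx:
  assumes "K > 0" "s \<in> zeta_domain K"
  shows "riemann_zeta s = zeta_approx K s"
proof (rule analytic_continuation_open[of "{s. Re s > 1}" "zeta_domain K" riemann_zeta "zeta_approx K"])
  show "open {s. Re s > 1}" by (rule open_halfspace_Re_gt)
  have "2 \<in> {s. Re s > 1}" by simp
  then show "{s. Re s > 1} \<noteq> {}" by blast
  show "{s. Re s > 1} \<subseteq> zeta_domain K" by (auto simp: zeta_domain_def)
  have "- {1} \<supseteq> zeta_domain K" by (auto simp: zeta_domain_def)
  then show "riemann_zeta holomorphic_on zeta_domain K"
    using is_riemann_zeta_riemann_zeta holomorphic_on_subset unfolding is_riemann_zeta_def by blast
  show "riemann_zeta z = zeta_approx K z" if "z \<in> {s. Re s > 1}" for z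
    using that zeta_approx_sums[OF assms(1)] is_riemann_zeta_riemann_zeta unfolding is_riemann_zeta_def
    by (auto intro: sums_unique2)
qed (fact assms holomorphic_zeta_approx[OF assms(1)] open_zeta_domain connected_zeta_domain)+

section \<open>Evaluation at 1 - m\<close>

text \<open>The binomials \<open>m choose k\<close> vanish for \<open>k > m\<close>, so truncating
  at any \<open>K \<ge> m\<close> loses nothing and the asymptotic expansion is exact.\<close>

lemma bern_series_of_nat:
  assumes "m \<le> K" "x > 0"
  shows "bern_series K (of_nat m) (of_nat x) = of_rat (bernpoly m (of_nat x))"
proof -
  have "bern_series K (of_nat m) (of_nat x) =
     (\<Sum>k\<le>m. (of_nat m gchoose k) * of_rat (bernoulli k) * of_nat x powr (of_nat m - of_nat k))"
    unfolding bern_series_def using assms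
    by (intro sum.mono_neutral_right) (auto simp: binomial_gbinomial[symmetric])
  also have "\<dots> = of_rat (bernpoly m (of_nat x))"
    unfolding bernpoly_def of_rat_sum
  proof (rule sum.cong[OF refl])
    fix k assume "k \<in> {..m}"
    then have "of_nat m - of_nat k = (of_nat (m - k) :: complex)" by (simp add: of_nat_diff)
    then show "(of_nat m gchoose k) * of_rat (bernoulli k) * of_nat x powr (of_nat m - of_nat k) =
      (of_rat (of_nat (m choose k) * bernoulli k * of_nat x ^ (m - k)) :: complex)"
      using assms by (simp add: powr_nat of_rat_mult of_rat_power flip: binomial_gbinomial)
  qed
  finally show ?thesis .
qed

theorem riemann_zeta_negative:
  assumes m: "m \<ge> 2"
  shows "riemann_zeta (1 - of_nat m) = - of_rat (bernoulli m / of_nat m)"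
proof -
  \<comment> \<open>The index must exceed \<open>m\<close> for the point 1 - m to lie in the open
    half-plane \<open>Re s > 1 - K\<close>.\<close>
  let ?K = "Suc m" and ?s = "1 - of_nat m :: complex"
  have "zeta_term ?K n ?s = 0" for n
  proof -
    have "bern_series ?K (of_nat m) (of_nat (Suc (Suc n))) - bern_series ?K (of_nat m) (of_nat (Suc n)) =
        of_rat (bernpoly m (of_nat (Suc (Suc n))) - bernpoly m (of_nat (Suc n)))"
      using bern_series_of_nat[of m ?K] by (simp add: of_rat_diff del: of_nat_Suc)
    also have "bernpoly m (of_nat (Suc (Suc n))) - bernpoly m (of_nat (Suc n)) = of_nat m * of_nat (Suc n) ^ (m - 1)"
      using bernpoly_add_1[of m "of_nat (Suc n)"] m by (simp add: add_ac)
    finally have *: "bern_series ?K (of_nat m) (of_nat (Suc (Suc n))) - bern_series ?K (of_nat m) (of_nat (Suc n)) =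
       of_nat m * of_nat (Suc n) ^ (m - 1)"
      by (simp add: of_rat_mult of_rat_power del: of_nat_Suc)
    have "of_nat (m - 1) = (- ?s :: complex)" using m by (simp add: of_nat_diff)
    then have "1 / of_nat (Suc n) powr ?s = (of_nat (Suc n) powr of_nat (m - 1) :: complex)"
      by (simp only: powr_minus_divide minus_minus)
    also have "\<dots> = of_nat (Suc n) ^ (m - 1)" by (simp add: powr_nat del: of_nat_Suc)
    finally show ?thesis unfolding zeta_term_def using * m by (simp del: of_nat_Suc)
  qed
  then have "zeta_approx ?K ?s = - of_rat (bernpoly m 1) / of_nat m"
    unfolding zeta_approx_def using bern_series_of_nat[of m ?K 1] by simp
  \<comment> \<open>The difference is m * 0^(m-1), which vanishes because
    \<open>m \<ge> 2\<close>.\<close>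
  also have "bernpoly m 1 = bernpoly m 0"
    using bernpoly_add_1[of m 0] m by (simp add: power_0_left)
  also have "bernpoly m 0 = bernoulli m"
    unfolding bernpoly_def by (subst sum.remove[of _ m]) (auto intro!: sum.neutral)
  finally have "zeta_approx ?K ?s = - of_rat (bernoulli m / of_nat m)"
    by (simp add: of_rat_divide)
  moreover have "?s \<in> zeta_domain ?K" using m by (simp add: zeta_domain_def)
  ultimately show ?thesis using riemann_zeta_eq_zeta_approx[of ?K ?s] by simp
qed

section \<open>Power sums modulo prime powers\<close>

lemma square_dvd_power_add:
  fixes x h :: int
  shows "h ^ 2 dvd (x + h) ^ m - x ^ m - of_nat m * x ^ (m - 1) * h"
proof (cases m)
  case (Suc k)
  have "h ^ 2 dvd (x + h) ^ Suc k - x ^ Suc k - of_nat (Suc k) * x ^ k * h"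
  proof (induction k)
    case (Suc k)
    have "(x + h) ^ Suc (Suc k) - x ^ Suc (Suc k) - of_nat (Suc (Suc k)) * x ^ Suc k * h =
       (x + h) * ((x + h) ^ Suc k - x ^ Suc k - of_nat (Suc k) * x ^ k * h) + of_nat (Suc k) * x ^ k * h ^ 2"
      by (simp add: algebra_simps power2_eq_square)
    then show ?case using Suc by simp
  qed simp
  then show ?thesis using Suc by simp
qed simp

lemma double_sum_int: "2 * (\<Sum>t<n. int t) = int n * (int n - 1)"
  by (induction n) (auto simp: algebra_simps)

lemma sixfold_sum_squares_int: "6 * (\<Sum>t<n. int t ^ 2) = int n * (int n - 1) * (2 * int n - 1)"
  by (induction n) (auto simp: algebra_simps power2_eq_square)

lemma bij_betw_mult_mod:
  fixes c P :: nat
  assumes "coprime c P" "P > 0"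
  shows "bij_betw (\<lambda>x. c * x mod P) {..<P} {..<P}"
proof -
  have "inj_on (\<lambda>x. c * x mod P) {..<P}"
  proof (rule inj_onI)
    fix x y assume *: "x \<in> {..<P}" "y \<in> {..<P}" "c * x mod P = c * y mod P"
    then have "[x = y] (mod P)" using assms(1) by (auto simp: cong_mult_lcancel_nat simp flip: cong_def)
    then show "x = y" using * by (simp add: cong_def)
  qed
  then show ?thesis using assms(2)
    unfolding bij_betw_def by (intro conjI endo_inj_surj) auto
qed

text \<open>Vandermonde's identity, whose \<open>i = 0\<close> term is the subtracted binomial;
  absorption in the other terms pulls out a factor \<open>d\<close>. This provides the divisibility
  by \<open>d\<close> in the congruences below.\<close>

lemma binomial_difference:
  assumes "d > 0" "j > 0"
  shows "of_nat (l + d choose j) - of_nat (l choose j) =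
     (of_nat d * (\<Sum>i=1..j. of_nat ((d - 1) choose (i - 1)) * of_nat (l choose (j - i)) / of_nat i) :: rat)"
proof -
  have "(l + d choose j) = (\<Sum>i\<le>j. (d choose i) * (l choose (j - i)))"
    using vandermonde[of d l j] by (simp add: add.commute)
  also have "{..j} = insert 0 {1..j}" by auto
  finally have "of_nat (l + d choose j) - of_nat (l choose j) = (\<Sum>i=1..j. of_nat (d choose i) * of_nat (l choose (j - i)) :: rat)"
    by simp
  also have "\<dots> = of_nat d * (\<Sum>i=1..j. of_nat ((d - 1) choose (i - 1)) * of_nat (l choose (j - i)) / of_nat i)"
    unfolding sum_distrib_left
  proof (intro sum.cong refl)
    fix i assume "i \<in> {1..j}"
    then have "i > 0" by simp
    then have "of_nat i * of_nat (d choose i) = (of_nat d * of_nat ((d-1) choose (i-1)) :: rat)"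
      using times_binomial_minus1_eq[of i d] by (metis of_nat_mult)
    with \<open>i > 0\<close> show "of_nat (d choose i) * of_nat (l choose (j - i)) =
       of_nat d * (of_nat ((d - 1) choose (i - 1)) * of_nat (l choose (j - i)) / of_nat i :: rat)"
      by (simp add: field_simps)
  qed
  finally show ?thesis .
qed

section \<open>The local ring at p and the control of denominators\<close>

locale prime_ge_5 =
  fixes p :: nat
  assumes prime_p: "prime p" and p_ge_5: "p \<ge> 5"
begin

abbreviation Z where "Z \<equiv> localization_at (int p)"
abbreviation q where "q \<equiv> (of_nat p :: rat)"

lemma p_pos [simp]: "p > 0" and p_nz [simp]: "p \<noteq> 0"
  using p_ge_5 by auto

lemma prime_int_p: "prime (int p)"
  using prime_p by simp

lemma ZI: "\<not> int p dvd b \<Longrightarrow> of_int a / of_int b \<in> Z"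
  unfolding localization_at_def by blast

lemma ZE:
  assumes "x \<in> Z"
  obtains a b where "x = of_int a / of_int b" "\<not> int p dvd b" "b \<noteq> 0"
  using assms unfolding localization_at_def by fastforce

lemma Z_of_int [simp, intro]: "of_int a \<in> Z"
  using ZI[of 1 a] p_ge_5 by simp

lemma Z_of_nat [simp, intro]: "of_nat a \<in> Z"
  using Z_of_int[of "int a"] by simp

lemma Z_0 [simp, intro]: "0 \<in> Z" and Z_1 [simp, intro]: "1 \<in> Z"
  using Z_of_int[of 0] Z_of_int[of 1] by simp_all

lemma Z_add [intro]: assumes "x \<in> Z" "y \<in> Z" shows "x + y \<in> Z"
proof -
  obtain a b c d where *: "x = of_int a / of_int b" "\<not> int p dvd b" "b \<noteq> 0"
    "y = of_int c / of_int d" "\<not> int p dvd d" "d \<noteq> 0"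
    using assms by (auto elim!: ZE)
  have "x + y = of_int (a * d + c * b) / of_int (b * d)"
    using * by (simp add: field_simps)
  also have "\<dots> \<in> Z" using * prime_int_p by (intro ZI) (simp add: prime_dvd_mult_iff)
  finally show ?thesis .
qed

lemma Z_mult [intro]: assumes "x \<in> Z" "y \<in> Z" shows "x * y \<in> Z"
proof -
  obtain a b c d where *: "x = of_int a / of_int b" "\<not> int p dvd b" "b \<noteq> 0"
    "y = of_int c / of_int d" "\<not> int p dvd d" "d \<noteq> 0"
    using assms by (auto elim!: ZE)
  have "x * y = of_int (a * c) / of_int (b * d)"
    using * by (simp add: field_simps)
  also have "\<dots> \<in> Z" using * prime_int_p by (intro ZI) (simp add: prime_dvd_mult_iff)
  finally show ?thesis .
qed

lemma Z_minus [intro]: "x \<in> Z \<Longrightarrow> - x \<in> Z"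
  using Z_mult[of "-1" x] Z_of_int[of "-1"] by simp

lemma Z_diff [intro]: "x \<in> Z \<Longrightarrow> y \<in> Z \<Longrightarrow> x - y \<in> Z"
  using Z_add[of x "-y"] by auto

lemma Z_sum [intro]: "(\<And>i. i \<in> A \<Longrightarrow> f i \<in> Z) \<Longrightarrow> sum f A \<in> Z"
  by (induction A rule: infinite_finite_induct) auto

lemma Z_power [intro]: "x \<in> Z \<Longrightarrow> x ^ n \<in> Z"
  by (induction n) auto

lemma Z_divide_unit:
  assumes "x \<in> Z" "\<not> p dvd b"
  shows "x / of_nat b \<in> Z"
proof -
  have "1 / of_nat b \<in> Z" using ZI[of "int b" 1] assms(2) by simp
  from Z_mult[OF assms(1) this] show ?thesis by simp
qed

lemma Z_q_power_mono:
  assumes "x / q ^ n \<in> Z" "m \<le> n"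
  shows "x / q ^ m \<in> Z"
proof -
  have "x / q ^ m = (x / q ^ n) * q ^ (n - m)"
    using assms(2) by (simp add: power_diff)
  also have "\<dots> \<in> Z" using assms(1) by (intro Z_mult Z_power Z_of_nat)
  finally show ?thesis .
qed

text \<open>With \<open>s\<close> the multiplicity of \<open>p\<close> in \<open>j\<close>,
  Bernoulli's inequality gives 4s + 1 <= 5^s <= p^s <= j. The linear bound reduces later comparisons
  of valuations to linear arithmetic.\<close>

lemma valuation_bound:
  assumes "j > 0"
  obtains s i where "j = p ^ s * i" "\<not> p dvd i" "4 * s + 1 \<le> j"
proof -
  obtain i where i: "j = p ^ multiplicity p j * i" "\<not> p dvd i"
    using multiplicity_decompose'[of j p] assms prime_p by (metis not_prime_unit gr_implies_not_zero)
  have "4 * s + 1 \<le> 5 ^ s" for s :: nat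
    by (induction s) auto
  also have "5 ^ multiplicity p j \<le> p ^ multiplicity p j"
    using p_ge_5 by (simp add: power_mono)
  also have "\<dots> \<le> j" using assms by (simp add: dvd_imp_le multiplicity_dvd)
  finally show ?thesis using that i by blast
qed

text \<open>From 4s + 1 <= j <= 4r + 4 follows s <= r, so the power of \<open>p\<close> in
  \<open>j\<close> is absorbed by \<open>q ^ r\<close>.\<close>

lemma Z_q_power_div:
  assumes "j > 0" "j \<le> 4 * r + 4"
  shows "q ^ r / of_nat j \<in> Z"
proof -
  obtain s i where *: "j = p ^ s * i" "\<not> p dvd i" "4 * s + 1 \<le> j"
    using valuation_bound[OF assms(1)] .
  have "q ^ r / of_nat j = (q ^ (r - s)) / of_nat i"
    using * assms by (simp add: power_diff)
  then show ?thesis using * by (auto intro: Z_divide_unit)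
qed

text \<open>The two valuations satisfy 4(s + t) + 2 <= i + j <= 4r + 5, hence s + t <= r.\<close>

lemma Z_q_power_div_2:
  assumes "i > 0" "j > 0" "i + j \<le> 4 * r + 5"
  shows "q ^ r / (of_nat i * of_nat j) \<in> Z"
proof -
  obtain s i' where i: "i = p ^ s * i'" "\<not> p dvd i'" "4 * s + 1 \<le> i"
    using valuation_bound[OF assms(1)] .
  obtain t j' where j: "j = p ^ t * j'" "\<not> p dvd j'" "4 * t + 1 \<le> j"
    using valuation_bound[OF assms(2)] .
  have st: "s + t \<le> r" using i(3) j(3) assms(3) by linarith
  have "q ^ r = q ^ (r - (s + t)) * (q ^ s * q ^ t)"
    using st by (simp flip: power_add)
  then have "q ^ r / (of_nat i * of_nat j) = q ^ (r - (s + t)) / of_nat (i' * j')"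
    using i j by simp
  also have "\<dots> \<in> Z" using i j prime_p
    by (intro Z_divide_unit Z_power Z_of_nat) (simp add: prime_dvd_mult_iff)
  finally show ?thesis .
qed

lemma eventually_Z: "\<forall>\<^sub>F r in sequentially. q ^ r * x \<in> Z"
proof -
  obtain a b where ab: "x = of_int a / of_int b" "b > 0"
    by (metis Rat_cases Fract_of_int_quotient)
  define c where "c = nat b"
  have c: "x = of_int a / of_nat c" "c > 0" using ab by (auto simp: c_def)
  obtain s i where *: "c = p ^ s * i" "\<not> p dvd i" "4 * s + 1 \<le> c"
    using valuation_bound[OF c(2)] .
  have "q ^ r * x \<in> Z" if "r \<ge> s" for r
  proof -
    have "q ^ r * x = (q ^ (r - s) * of_int a) / of_nat i"
      using * that c by (simp add: power_diff)
    then show ?thesis using * by (auto intro: Z_divide_unit)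
  qed
  then show ?thesis by (auto simp: eventually_sequentially)
qed

section \<open>Bernoulli numbers as p-adic limits of averages\<close>

definition average :: "nat \<Rightarrow> (nat \<Rightarrow> rat) \<Rightarrow> rat" where
  "average N f = (\<Sum>x<p ^ N. f x) / q ^ N"

text \<open>Convergence in the p-adic sense: \<open>y\<close> is an arbitrary prescribed precision.
  In the power sum formula the term \<open>k = n\<close> is the limit, and every other term carries
  \<open>q\<close> to an exponent at least \<open>N\<close>, which eventually clears all fixed
  denominators.\<close>

lemma eventually_average_power:
  "\<forall>\<^sub>F N in sequentially. (average N (\<lambda>x. of_nat x ^ n) - bernoulli n) / y \<in> Z"
proof -
  define c where "c k = of_nat (Suc n choose k) * bernoulli k / of_nat (n + 1) / y" for k
  have "\<forall>\<^sub>F N in sequentially. \<forall>k\<in>{..<n}. \<forall>r\<ge>N. q ^ r * c k \<in> Z"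
    by (intro eventually_ball_finite ballI eventually_all_ge_at_top eventually_Z finite_lessThan)
  then show ?thesis
  proof eventually_elim
    case (elim N)
    have "average N (\<lambda>x. of_nat x ^ n) = of_nat (n + 1) * (\<Sum>x<p ^ N. of_nat x ^ n) / (of_nat (n + 1) * q ^ N)"
      by (simp add: average_def del: of_nat_add of_nat_Suc)
    also have "\<dots> = (\<Sum>k\<le>n. of_nat (Suc n choose k) * bernoulli k * q ^ (N * (Suc n - k))) / (of_nat (n + 1) * q ^ N)"
      unfolding sum_powers_bernoulli by (simp add: power_mult)
    also have "\<dots> = (\<Sum>k\<le>n. of_nat (Suc n choose k) * bernoulli k / of_nat (n + 1) * q ^ (N * (n - k)))"
      unfolding sum_divide_distrib
      by (intro sum.cong refl) (auto simp: Suc_diff_le power_add simp del: of_nat_Suc of_nat_add)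
    also have "\<dots> = bernoulli n + (\<Sum>k<n. of_nat (Suc n choose k) * bernoulli k / of_nat (n + 1) * q ^ (N * (n - k)))"
      by (simp flip: lessThan_Suc_atMost del: of_nat_Suc)
    finally have "(average N (\<lambda>x. of_nat x ^ n) - bernoulli n) / y = (\<Sum>k<n. q ^ (N * (n - k)) * c k)"
      by (simp add: c_def sum_divide_distrib mult_ac del: of_nat_Suc)
    also have "\<dots> \<in> Z"
    proof (intro Z_sum)
      fix k assume "k \<in> {..<n}"
      then have "N \<le> N * (n - k)" and "k \<in> {..<n}" by auto
      then show "q ^ (N * (n - k)) * c k \<in> Z" using elim by blast
    qed
    finally show ?case .
  qed
qed

text \<open>Solves the formula for the power sum over x < p for \<open>q * bernoulli n\<close>. By
  strong induction the remaining terms are integral, since p^(n-k) / (n+1-k) is.\<close>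

lemma p_bernoulli: "q * bernoulli n \<in> Z"
proof (induction n rule: less_induct)
  case (less n)
  have "of_nat (n + 1) * (\<Sum>x<p. of_nat x ^ n :: rat) =
      of_nat (n + 1) * (q * bernoulli n) + (\<Sum>k<n. of_nat (Suc n choose k) * bernoulli k * q ^ (Suc n - k))"
    unfolding sum_powers_bernoulli by (simp flip: lessThan_Suc_atMost add: mult_ac del: of_nat_Suc)
  moreover have "(\<Sum>k<n. of_nat (Suc n choose k) * bernoulli k * q ^ (Suc n - k)) =
      of_nat (n + 1) * (\<Sum>k<n. of_nat (n choose k) * (q * bernoulli k) * (q ^ (n - k) / of_nat (Suc n - k)))"
    unfolding sum_distrib_left
  proof (intro sum.cong refl)
    fix k assume "k \<in> {..<n}"
    then have k: "k < n" by simp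
    have "of_nat (Suc n - k) * of_nat (Suc n choose k) = (of_nat (n + 1) * of_nat (n choose k) :: rat)"
      using binomial_absorb_comp[of "Suc n" k] by (metis Suc_eq_plus1 diff_Suc_1 of_nat_mult)
    moreover have "of_nat (Suc n - k) \<noteq> (0::rat)" using k by (subst of_nat_eq_0_iff) simp
    ultimately have "of_nat (Suc n choose k) = (of_nat (n + 1) * of_nat (n choose k) / of_nat (Suc n - k) :: rat)"
      by (simp add: field_simps)
    moreover have "q ^ (Suc n - k) = q * q ^ (n - k)" using k by (simp add: Suc_diff_le)
    ultimately show "of_nat (Suc n choose k) * bernoulli k * q ^ (Suc n - k) =
      of_nat (n + 1) * (of_nat (n choose k) * (q * bernoulli k) * (q ^ (n - k) / of_nat (Suc n - k)))"
      by simp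
  qed
  ultimately have "of_nat (n + 1) * (\<Sum>x<p. of_nat x ^ n :: rat) = of_nat (n + 1) * (q * bernoulli n +
     (\<Sum>k<n. of_nat (n choose k) * (q * bernoulli k) * (q ^ (n - k) / of_nat (Suc n - k))))"
    by (simp only: distrib_left)
  then have "(\<Sum>x<p. of_nat x ^ n :: rat) = q * bernoulli n +
     (\<Sum>k<n. of_nat (n choose k) * (q * bernoulli k) * (q ^ (n - k) / of_nat (Suc n - k)))"
    by (subst (asm) mult_cancel_left) (simp del: of_nat_Suc of_nat_add)
  then have "q * bernoulli n = (\<Sum>x<p. of_nat x ^ n) -
     (\<Sum>k<n. of_nat (n choose k) * (q * bernoulli k) * (q ^ (n - k) / of_nat (Suc n - k)))"
    by simp
  also have "\<dots> \<in> Z"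
    by (intro Z_diff Z_sum Z_power Z_of_nat Z_mult[OF Z_mult[OF Z_of_nat less.IH] Z_q_power_div]) auto
  finally show ?case .
qed

section \<open>The congruences of Voronoi and Kummer\<close>

text \<open>In the binomial expansion the terms of order 0 and 1 cancel. For j >= 2, absorption
  cancels \<open>n\<close> and leaves p^(N(j-2)) / j times an integer.\<close>

lemma power_add_p_power_mult:
  fixes g y :: nat
  assumes "n > 0" "N > 0"
  shows "((of_nat (p ^ N * g + y) ^ n - of_nat y ^ n) / (of_nat n * q ^ N) - of_nat (g * y ^ (n - 1))) / q ^ N \<in> Z"
proof -
  have "{..n} = {0,1} \<union> {2..n}" using assms by auto
  then have "of_nat (p ^ N * g + y) ^ n = (\<Sum>j\<in>{0,1}. of_nat (n choose j) * (q ^ N * of_nat g) ^ j * of_nat y ^ (n - j))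
      + (\<Sum>j=2..n. of_nat (n choose j) * (q ^ N * of_nat g) ^ j * of_nat y ^ (n - j))"
    by (simp add: binomial_ring sum.union_disjoint)
  also have "\<dots> = of_nat y ^ n + of_nat n * q ^ N * of_nat (g * y ^ (n - 1)) +
      (\<Sum>j=2..n. of_nat (n choose j) * (q ^ N * of_nat g) ^ j * of_nat y ^ (n - j))"
    by simp
  finally have "((of_nat (p ^ N * g + y) ^ n - of_nat y ^ n) / (of_nat n * q ^ N) - of_nat (g * y ^ (n - 1))) / q ^ N
      = (\<Sum>j=2..n. of_nat (n choose j) * (q ^ N * of_nat g) ^ j * of_nat y ^ (n - j)) / (of_nat n * q ^ N * q ^ N)"
    using assms by (simp add: divide_simps)
  also have "\<dots> = (\<Sum>j=2..n. of_nat ((n-1) choose (j-1)) * of_nat g ^ j * of_nat y ^ (n - j) * (q ^ (N * (j-2)) / of_nat j))"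
    unfolding sum_divide_distrib
  proof (intro sum.cong refl)
    fix j assume "j \<in> {2..n}"
    then have j: "2 \<le> j" "j \<le> n" by auto
    have "of_nat j * of_nat (n choose j) = (of_nat n * of_nat ((n-1) choose (j-1)) :: rat)"
      using times_binomial_minus1_eq[of j n] j by (metis of_nat_mult gr_zeroI not_numeral_le_zero)
    then have 1: "of_nat (n choose j) = (of_nat n * of_nat ((n-1) choose (j-1)) / of_nat j :: rat)"
      using j by (simp add: field_simps)
    have "(q ^ N) ^ j = q ^ N * q ^ N * q ^ (N * (j - 2))"
      using j by (simp flip: power_add power_mult add: algebra_simps)
    then show "of_nat (n choose j) * (q ^ N * of_nat g) ^ j * of_nat y ^ (n - j) / (of_nat n * q ^ N * q ^ N) =
       of_nat ((n-1) choose (j-1)) * of_nat g ^ j * of_nat y ^ (n - j) * (q ^ (N * (j-2)) / of_nat j)"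
      using assms j unfolding 1 power_mult_distrib by simp
  qed
  also have "\<dots> \<in> Z"
  proof (intro Z_sum Z_mult Z_power Z_of_nat Z_q_power_div)
    fix j assume "j \<in> {2..n}"
    then obtain i where i: "j = i + 2" by (auto simp: le_iff_add add.commute)
    have "i \<le> N * i" using assms by (cases N) auto
    then show "j \<le> 4 * (N * (j - 2)) + 4" unfolding i diff_add_inverse2 by linarith
  qed auto
  finally show ?thesis .
qed

text \<open>Since x -> c x mod p^N permutes the residues, (c^n - 1) times the power sum is the sum
  of (c x)^n - (c x mod p^N)^n, and \<open>power_add_p_power_mult\<close> applies to each summand
  with c x split by division by p^N.\<close>

lemma voronoi:
  assumes "coprime c p" "n > 0" "N > 0"
  shows "((of_nat c ^ n - 1) * average N (\<lambda>x. of_nat x ^ n) / of_nat n -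
     (\<Sum>x<p^N. of_nat ((c * x div p ^ N) * (c * x mod p ^ N) ^ (n - 1)))) / q ^ N \<in> Z"
proof -
  let ?y = "\<lambda>x. c * x mod p ^ N" and ?g = "\<lambda>x. c * x div p ^ N"
  have "(\<Sum>x<p^N. of_nat (?y x) ^ n) = (\<Sum>x<p^N. of_nat x ^ n :: rat)"
    using assms(1) by (intro sum.reindex_bij_betw[OF bij_betw_mult_mod]) auto
  then have "(of_nat c ^ n - 1) * average N (\<lambda>x. of_nat x ^ n) = (\<Sum>x<p^N. of_nat (c * x) ^ n - of_nat (?y x) ^ n) / q ^ N"
    unfolding average_def
    by (simp add: sum_subtractf power_mult_distrib left_diff_distrib diff_divide_distrib flip: sum_distrib_left)
  then have "((of_nat c ^ n - 1) * average N (\<lambda>x. of_nat x ^ n) / of_nat n -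
     (\<Sum>x<p^N. of_nat (?g x * ?y x ^ (n - 1)))) / q ^ N =
     (\<Sum>x<p^N. ((of_nat (p ^ N * ?g x + ?y x) ^ n - of_nat (?y x) ^ n) / (of_nat n * q ^ N) - of_nat (?g x * ?y x ^ (n - 1))) / q ^ N)"
    unfolding mult_div_mod_eq
    by (simp add: sum_divide_distrib sum_subtractf diff_divide_distrib mult.commute[of "q ^ N"]
        del: of_nat_mult of_nat_power)
  also have "\<dots> \<in> Z" using assms by (intro Z_sum power_add_p_power_mult) auto
  finally show ?thesis .
qed

lemma exists_unit_power_minus_1:
  assumes "\<not> (p - 1) dvd n"
  obtains c where "coprime c p" "\<not> p dvd c ^ n - 1" "c > 0"
proof -
  obtain g where "residue_primroot p g"
    using prime_primitive_root_exists[of p] prime_p prime_gt_1_nat by auto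
  then have g: "coprime p g" "ord p g = p - 1"
    using prime_p by (auto simp: residue_primroot_def totient_prime)
  then have "\<not> [g ^ n = 1] (mod p)" using assms by (metis ord_divides)
  moreover have "g > 0" using g prime_p by (cases g) auto
  ultimately have "\<not> p dvd g ^ n - 1"
    by (metis One_nat_def cong_altdef_nat cong_sym less_eq_Suc_le nat_zero_less_power_iff)
  then show ?thesis using that g \<open>g > 0\<close> by (auto simp: coprime_commute)
qed

text \<open>Replaces the average by its limit; the precision \<open>q ^ a * of_nat n\<close>
  accounts for the division by \<open>n\<close>. What remains to compare for different
  \<open>n\<close> is the natural number \<open>F c n N\<close>.\<close>

lemma Z_voronoi_cong:
  fixes F :: "nat \<Rightarrow> nat \<Rightarrow> nat \<Rightarrow> nat"
  defines "F \<equiv> \<lambda>c n N. \<Sum>x<p^N. (c * x div p ^ N) * (c * x mod p ^ N) ^ (n - 1)"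
  assumes "coprime c p" "n > 0"
  shows "\<forall>\<^sub>F N in sequentially. ((of_nat c ^ n - 1) * (bernoulli n / of_nat n) - of_nat (F c n N)) / q ^ a \<in> Z"
  using eventually_average_power[of n "q ^ a * of_nat n"] eventually_gt_at_top[of 0] eventually_ge_at_top[of a]
proof eventually_elim
  case (elim N)
  let ?A = "average N (\<lambda>x. of_nat x ^ n)"
  have "((of_nat c ^ n - 1) * ?A / of_nat n - of_nat (F c n N)) / q ^ N \<in> Z"
    using voronoi[of c n N] assms elim by simp
  then have "((of_nat c ^ n - 1) * ?A / of_nat n - of_nat (F c n N)) / q ^ a \<in> Z"
    using elim by (rule_tac Z_q_power_mono)
  then have "((of_nat c ^ n - 1) * ?A / of_nat n - of_nat (F c n N)) / q ^ a
     - (of_nat c ^ n - 1) * ((?A - bernoulli n) / (q ^ a * of_nat n)) \<in> Z"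
    using elim by (intro Z_diff Z_mult Z_power Z_of_nat Z_1)
  also have "((of_nat c ^ n - 1) * ?A / of_nat n - of_nat (F c n N)) / q ^ a
     - (of_nat c ^ n - 1) * ((?A - bernoulli n) / (q ^ a * of_nat n)) =
     ((of_nat c ^ n - 1) * (bernoulli n / of_nat n) - of_nat (F c n N)) / q ^ a"
    using assms by (simp add: field_simps)
  finally show ?case .
qed

lemma Z_cong_nat:
  fixes x y :: nat
  assumes "[x = y] (mod p ^ a)"
  shows "(of_nat x - of_nat y) / q ^ a \<in> Z"
proof -
  have "int (p ^ a) dvd int x - int y"
    using assms by (simp add: cong_iff_dvd_diff flip: cong_int_iff)
  then obtain k where "int x - int y = int (p ^ a) * k" by blast
  then have "of_int (int x - int y) = (of_int (int (p ^ a) * k) :: rat)" by simp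
  then have "(of_nat x - of_nat y) / q ^ a = of_int k" by simp
  then show ?thesis by simp
qed

lemma bernoulli_divide_in_Z:
  assumes "\<not> (p - 1) dvd n"
  shows "bernoulli n / of_nat n \<in> Z"
proof -
  obtain c where c: "coprime c p" "\<not> p dvd c ^ n - 1" "c > 0"
    using exists_unit_power_minus_1[OF assms] .
  have "n > 0" using assms by (cases n) auto
  from eventually_happens'[OF sequentially_bot Z_voronoi_cong[OF c(1) this, of 0]] obtain x where
    "((of_nat c ^ n - 1) * (bernoulli n / of_nat n) - of_nat x) \<in> Z"
    unfolding power_0 div_by_1 by blast
  from Z_add[OF this Z_of_nat[of x]]
  have "(of_nat c ^ n - 1) * (bernoulli n / of_nat n) / of_nat (c ^ n - 1) \<in> Z"
    using c by (intro Z_divide_unit) auto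
  moreover have "of_nat (c ^ n - 1) = (of_nat c ^ n - 1 :: rat)"
    using c by (simp add: of_nat_diff)
  moreover have "c ^ n - 1 \<noteq> 0" using c(2) by (metis dvd_0_right)
  ultimately show ?thesis by (metis nonzero_mult_div_cancel_left of_nat_eq_0_iff)
qed

text \<open>The Voronoi sums for \<open>n\<close> and \<open>m\<close>, taken at a common
  \<open>N\<close>, agree termwise modulo p^a, and so do c^n and c^m; finally the unit c^n - 1 is
  divided out. The hypothesis covers all \<open>y\<close> because \<open>c * x mod p ^ N\<close> may
  be divisible by \<open>p\<close>.\<close>

lemma kummer_cong:
  assumes "\<not> (p - 1) dvd n" "\<not> (p - 1) dvd m"
    and powers: "\<And>y. [y ^ (n - 1) = y ^ (m - 1)] (mod p ^ a)"
  shows "(bernoulli n / of_nat n - bernoulli m / of_nat m) / q ^ a \<in> Z"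
proof -
  obtain c where c: "coprime c p" "\<not> p dvd c ^ n - 1" "c > 0"
    using exists_unit_power_minus_1[OF assms(1)] .
  have pos: "n > 0" "m > 0" using assms by (auto intro!: Nat.gr0I)
  let ?F = "\<lambda>n N. \<Sum>x<p^N. (c * x div p ^ N) * (c * x mod p ^ N) ^ (n - 1)"
  let ?b = "\<lambda>n. bernoulli n / of_nat n"
  have "\<forall>\<^sub>F N in sequentially. ((of_nat c ^ n - 1) * ?b n - of_nat (?F n N)) / q ^ a \<in> Z \<and>
      ((of_nat c ^ m - 1) * ?b m - of_nat (?F m N)) / q ^ a \<in> Z"
    using Z_voronoi_cong[OF c(1) pos(1)] Z_voronoi_cong[OF c(1) pos(2)] by (rule eventually_conj)
  then obtain N where N: "((of_nat c ^ n - 1) * ?b n - of_nat (?F n N)) / q ^ a \<in> Z"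
      "((of_nat c ^ m - 1) * ?b m - of_nat (?F m N)) / q ^ a \<in> Z"
    using eventually_happens'[OF sequentially_bot] by blast
  have "[?F n N = ?F m N] (mod p ^ a)"
    by (intro cong_sum cong_mult powers cong_refl)
  then have F: "(of_nat (?F n N) - of_nat (?F m N)) / q ^ a \<in> Z" by (rule Z_cong_nat)
  have "[c * c ^ (n - 1) = c * c ^ (m - 1)] (mod p ^ a)"
    by (intro cong_mult powers cong_refl)
  then have "[c ^ n = c ^ m] (mod p ^ a)" using pos by (simp flip: power_Suc)
  from Z_cong_nat[OF this] have C: "(of_nat c ^ n - of_nat c ^ m) / q ^ a \<in> Z" by simp
  have alg: "((C - 1) * x - F) / Q - ((D - 1) * y - G) / Q + (F - G) / Q - (C - D) / Q * y = (C - 1) * ((x - y) / Q)"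
    for C D F G Q x y :: rat
    by (simp add: diff_divide_distrib add_divide_distrib algebra_simps)
  have "((of_nat c ^ n - 1) * ?b n - of_nat (?F n N)) / q ^ a - ((of_nat c ^ m - 1) * ?b m - of_nat (?F m N)) / q ^ a
     + (of_nat (?F n N) - of_nat (?F m N)) / q ^ a - (of_nat c ^ n - of_nat c ^ m) / q ^ a * ?b m \<in> Z"
    using N F C bernoulli_divide_in_Z[OF assms(2)] by (intro Z_add Z_diff Z_mult)
  also have "((of_nat c ^ n - 1) * ?b n - of_nat (?F n N)) / q ^ a - ((of_nat c ^ m - 1) * ?b m - of_nat (?F m N)) / q ^ a
     + (of_nat (?F n N) - of_nat (?F m N)) / q ^ a - (of_nat c ^ n - of_nat c ^ m) / q ^ a * ?b m =
     (of_nat c ^ n - 1) * ((?b n - ?b m) / q ^ a)"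
    by (rule alg)
  finally have "(of_nat c ^ n - 1) * ((?b n - ?b m) / q ^ a) / of_nat (c ^ n - 1) \<in> Z"
    using c by (intro Z_divide_unit) auto
  moreover have "of_nat (c ^ n - 1) = (of_nat c ^ n - 1 :: rat)"
    using c by (simp add: of_nat_diff)
  moreover have "c ^ n - 1 \<noteq> 0" using c(2) by (metis dvd_0_right)
  ultimately show ?thesis by (metis nonzero_mult_div_cancel_left of_nat_eq_0_iff)
qed

section \<open>Fermat quotients along residue classes\<close>

lemma p_not_dvd_small: "0 < k \<Longrightarrow> k \<le> 4 \<Longrightarrow> \<not> int p dvd k"
  using p_ge_5 zdvd_imp_le[of "int p" k] by auto

lemma p_dvd_sum_int: "int p dvd (\<Sum>t<p. int t)"
  using double_sum_int[of p] p_not_dvd_small[of 2] prime_int_p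
  by (metis dvd_triv_left prime_dvd_multD zero_less_numeral numeral_le_iff semiring_norm(68,69,71,76))

lemma p_dvd_sum_squares_int: "int p dvd (\<Sum>t<p. int t ^ 2)"
proof -
  have "int p dvd 2 * (3 * (\<Sum>t<p. int t ^ 2))"
    using sixfold_sum_squares_int[of p] by simp
  then have "int p dvd 3 * (\<Sum>t<p. int t ^ 2)"
    using p_not_dvd_small[of 2] prime_dvd_multD[OF prime_int_p] by fastforce
  then show ?thesis
    using p_not_dvd_small[of 3] prime_dvd_multD[OF prime_int_p] by fastforce
qed

definition fermat_quotient :: "nat \<Rightarrow> nat" where
  "fermat_quotient x = (x ^ (p - 1) - 1) div p"

abbreviation "w \<equiv> fermat_quotient"

lemma power_eq_fermat_quotient:
  assumes "\<not> p dvd x"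
  shows "x ^ (p - 1) = 1 + p * w x"
proof -
  have "x > 0" using assms by (cases x) auto
  then have "p dvd x ^ (p - 1) - 1"
    using fermat_theorem[OF prime_p assms] by (subst (asm) cong_altdef_nat) (auto simp: Suc_leI)
  then show ?thesis using \<open>x > 0\<close> by (simp add: fermat_quotient_def Suc_leI)
qed

text \<open>Modulo p^(2N) the power (x + p^N t)^(p-1) is affine in \<open>t\<close>. As 2N >= N + 1,
  dividing by \<open>p\<close> leaves an affine formula modulo p^N whose slope does not depend on
  \<open>t\<close>.\<close>

lemma fermat_quotient_shift:
  assumes "\<not> p dvd x" "N > 0"
  obtains s where
    "\<And>t. [int (w (x + p ^ N * t)) = int (w x) + int p ^ (N - 1) * s * int t] (mod int p ^ N)"
proof
  \<comment> \<open>The derivative of x^(p-1).\<close>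
  let ?s = "int (p - 1) * int x ^ (p - 2)"
  fix t
  have x': "\<not> p dvd x + p ^ N * t" using assms by (simp add: dvd_add_left_iff)
  have *: "int y ^ (p - 1) = 1 + int p * int (w y)" if "\<not> p dvd y" for y
    using power_eq_fermat_quotient[OF that] by (metis of_nat_1 of_nat_add of_nat_mult of_nat_power)
  have "(int p ^ N * int t) ^ 2 dvd (int x + int p ^ N * int t) ^ (p - 1) - int x ^ (p - 1)
      - int (p - 1) * int x ^ (p - 1 - 1) * (int p ^ N * int t)"
    by (rule square_dvd_power_add)
  also have "int x + int p ^ N * int t = int (x + p ^ N * t)" by simp
  also have "int (x + p ^ N * t) ^ (p - 1) - int x ^ (p - 1) - int (p - 1) * int x ^ (p - 1 - 1) * (int p ^ N * int t)
    = int p * (int (w (x + p ^ N * t)) - (int (w x) + int p ^ (N - 1) * ?s * int t))"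
    unfolding *[OF assms(1)] *[OF x'] using assms(2)
    by (cases N) (auto simp: algebra_simps numeral_2_eq_2)
  finally have "(int p ^ N * int t) ^ 2 dvd int p * (int (w (x + p ^ N * t)) - (int (w x) + int p ^ (N - 1) * ?s * int t))" .
  moreover have "int p * int p ^ N dvd (int p ^ N * int t) ^ 2"
    using assms(2) by (cases N) (auto simp: power2_eq_square)
  ultimately have "int p * int p ^ N dvd int p * (int (w (x + p ^ N * t)) - (int (w x) + int p ^ (N - 1) * ?s * int t))"
    by (rule dvd_trans[rotated])
  then show "[int (w (x + p ^ N * t)) = int (w x) + int p ^ (N - 1) * ?s * int t] (mod int p ^ N)"
    by (simp add: cong_iff_dvd_diff)
qed

text \<open>The linear term vanishes modulo p^N because the sum of all t < p supplies the missing
  factor \<open>p\<close>. For N >= 2 already h^2 is divisible by p^N; for N = 1 it may not be, and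
  the case j = 2 uses the sum of squares instead.\<close>

lemma sum_power_arithmetic_progression:
  fixes a h :: int
  assumes h: "int p ^ (N - 1) dvd h" and N: "N > 0" and j: "N \<ge> 2 \<or> j \<le> 2"
  shows "int p ^ N dvd (\<Sum>t<p. (a + h * int t) ^ j) - int p * a ^ j"
proof -
  have dvd1: "int p ^ N dvd h * (\<Sum>t<p. int t)"
    using mult_dvd_mono[OF h p_dvd_sum_int] N by (simp flip: power_Suc2)
  consider "N \<ge> 2" | "j = 0" | "j = 1" | "j = 2" using j by linarith
  then show ?thesis
  proof cases
    case 1
    have "int p ^ N dvd int p ^ (N - 1) * int p ^ (N - 1)"
      using 1 by (simp flip: power_add add: le_imp_power_dvd)
    also have "\<dots> dvd h ^ 2" using mult_dvd_mono[OF h h] by (simp add: power2_eq_square)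
    finally have h2: "int p ^ N dvd h ^ 2" .
    have "int p ^ N dvd (\<Sum>t<p. (a + h * int t) ^ j - a ^ j - of_nat j * a ^ (j - 1) * (h * int t))"
      by (intro dvd_sum dvd_trans[OF _ square_dvd_power_add]) (simp add: power_mult_distrib h2)
    also have "(\<Sum>t<p. (a + h * int t) ^ j - a ^ j - of_nat j * a ^ (j - 1) * (h * int t)) =
      ((\<Sum>t<p. (a + h * int t) ^ j) - int p * a ^ j) - of_nat j * a ^ (j - 1) * (h * (\<Sum>t<p. int t))"
      by (simp add: sum_subtractf sum_distrib_left)
    finally show ?thesis using dvd1 by (subst (asm) dvd_diff_left_iff) auto
  next
    case 3
    then show ?thesis using dvd1 by (simp add: sum.distrib sum_distrib_left)
  next
    case 4
    have "int p ^ N dvd h * (h * (\<Sum>t<p. int t ^ 2))"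
      using mult_dvd_mono[OF h p_dvd_sum_squares_int] N by (simp flip: power_Suc2)
    moreover have "(\<Sum>t<p. (a + h * int t) ^ 2) = (\<Sum>t<p. a ^ 2 + 2 * a * (h * int t) + h * (h * int t ^ 2))"
      by (intro sum.cong refl) (simp add: power2_eq_square algebra_simps)
    then have "(\<Sum>t<p. (a + h * int t) ^ 2) - int p * a ^ 2 =
       2 * a * (h * (\<Sum>t<p. int t)) + h * (h * (\<Sum>t<p. int t ^ 2))"
      by (simp add: sum.distrib sum_distrib_left)
    ultimately show ?thesis using dvd1 4 by simp
  qed auto
qed

section \<open>Averages over units and moments of the Fermat quotient\<close>

definition units :: "nat \<Rightarrow> nat set" where
  "units N = {x. x < p ^ N \<and> \<not> p dvd x}"

text \<open>Normalized by p^N and not by the number of units, so that it is the unit part of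
  \<open>average\<close>; a constant 1 therefore averages to 1 - 1/p.\<close>

definition unit_average :: "nat \<Rightarrow> (nat \<Rightarrow> rat) \<Rightarrow> rat" where
  "unit_average N f = (\<Sum>x\<in>units N. f x) / q ^ N"

lemma finite_units [simp]: "finite (units N)"
  unfolding units_def by (rule finite_subset[of _ "{..<p^N}"]) auto

lemma sum_units_Suc:
  assumes "N > 0"
  shows "(\<Sum>x\<in>units (Suc N). f x) = (\<Sum>x\<in>units N. \<Sum>t<p. f (x + p ^ N * t))"
proof -
  have pN: "p dvd p ^ N" using assms by simp
  have lt: "a + p ^ N * b < p * p ^ N" if "a < p ^ N" "b < p" for a b
  proof -
    have "a + p ^ N * b < p ^ N * (b + 1)" using that by simp
    also have "\<dots> \<le> p ^ N * p" using that by (intro mult_le_mono2) auto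
    finally show ?thesis by (simp add: mult.commute)
  qed
  show ?thesis unfolding sum.cartesian_product
    by (rule sum.reindex_bij_witness[of _ "\<lambda>(x, t). x + p ^ N * t" "\<lambda>x. (x mod p ^ N, x div p ^ N)"])
      (use assms lt pN in \<open>auto simp: units_def dvd_mod_iff less_mult_imp_div_less dvd_add_left_iff\<close>)
qed

lemma unit_average_1:
  assumes "N > 0"
  shows "unit_average N (\<lambda>_. 1) = 1 - 1 / q"
  using assms
proof (induction N rule: nat_induct_non_zero)
  case 1
  have "units 1 = {1..<p}"
    by (auto simp: units_def intro!: Suc_leI Nat.gr0I dest: nat_dvd_not_less)
  then show ?case by (simp add: unit_average_def of_nat_diff Suc_leI diff_divide_distrib)
next
  case (Suc N)
  then show ?case unfolding unit_average_def sum_units_Suc[OF Suc.hyps] by simp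
qed

text \<open>The multiples of \<open>p\<close> below p^(N+1) are p times the numbers below p^N; the
  factor p^n against one extra \<open>p\<close> in the denominator leaves p^(n-1).\<close>

lemma average_power_split:
  assumes "n > 0"
  shows "average (Suc N) (\<lambda>x. of_nat x ^ n) =
     unit_average (Suc N) (\<lambda>x. of_nat x ^ n) + q ^ (n - 1) * average N (\<lambda>x. of_nat x ^ n)"
proof -
  have "{..<p ^ Suc N} = units (Suc N) \<union> (\<lambda>x. p * x) ` {..<p ^ N}"
    by (auto simp: units_def elim!: dvdE)
  moreover have "units (Suc N) \<inter> (\<lambda>x. p * x) ` {..<p ^ N} = {}" by (auto simp: units_def)
  ultimately have "(\<Sum>x<p ^ Suc N. of_nat x ^ n) =
     (\<Sum>x\<in>units (Suc N). of_nat x ^ n) + (\<Sum>x\<in>(\<lambda>x. p * x) ` {..<p ^ N}. of_nat x ^ n :: rat)"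
    by (simp add: sum.union_disjoint)
  also have "(\<Sum>x\<in>(\<lambda>x. p * x) ` {..<p ^ N}. of_nat x ^ n :: rat) = q ^ n * (\<Sum>x<p ^ N. of_nat x ^ n)"
    by (subst sum.reindex) (auto simp: inj_on_def power_mult_distrib sum_distrib_left)
  finally show ?thesis using assms
    by (cases n) (simp_all add: average_def unit_average_def add_divide_distrib)
qed

abbreviation moment :: "nat \<Rightarrow> nat \<Rightarrow> rat" where
  "moment N j \<equiv> unit_average N (\<lambda>x. of_nat (w x) ^ j)"

text \<open>The \<open>p\<close> lifts of a unit \<open>x\<close> contribute p w(x)^j modulo p^N in
  total, so the two sums over p^(N+1) differ by a multiple of p^N: each refinement costs at most one
  factor \<open>p\<close> in the denominator.\<close>

lemma moment_Suc_diff: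
  assumes N: "N > 0" and j: "N \<ge> 2 \<or> j \<le> 2"
  shows "q * (moment (Suc N) j - moment N j) \<in> Z"
proof -
  have "int p ^ N dvd (\<Sum>x\<in>units N. (\<Sum>t<p. int (w (x + p ^ N * t)) ^ j) - int p * int (w x) ^ j)"
  proof (intro dvd_sum)
    fix x assume "x \<in> units N"
    then have "\<not> p dvd x" by (simp add: units_def)
    from fermat_quotient_shift[OF this N] obtain s where
      s: "\<And>t. [int (w (x + p ^ N * t)) = int (w x) + int p ^ (N - 1) * s * int t] (mod int p ^ N)"
      by blast
    have "[(\<Sum>t<p. int (w (x + p ^ N * t)) ^ j) = (\<Sum>t<p. (int (w x) + int p ^ (N - 1) * s * int t) ^ j)] (mod int p ^ N)"
      by (intro cong_sum cong_pow s)
    moreover have "[(\<Sum>t<p. (int (w x) + int p ^ (N - 1) * s * int t) ^ j) = int p * int (w x) ^ j] (mod int p ^ N)"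
      unfolding cong_iff_dvd_diff using N j by (intro sum_power_arithmetic_progression) auto
    ultimately show "int p ^ N dvd (\<Sum>t<p. int (w (x + p ^ N * t)) ^ j) - int p * int (w x) ^ j"
      unfolding cong_iff_dvd_diff[symmetric] by (rule cong_trans)
  qed
  then obtain z where "(\<Sum>x\<in>units N. (\<Sum>t<p. int (w (x + p ^ N * t)) ^ j) - int p * int (w x) ^ j) = int p ^ N * z"
    by blast
  then have "rat_of_int (\<Sum>x\<in>units N. (\<Sum>t<p. int (w (x + p ^ N * t)) ^ j) - int p * int (w x) ^ j) = rat_of_int (int p ^ N * z)"
    by simp
  then have "(\<Sum>x\<in>units N. \<Sum>t<p. rat_of_nat (w (x + p ^ N * t)) ^ j) - q * (\<Sum>x\<in>units N. rat_of_nat (w x) ^ j) = q ^ N * of_int z"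
    by (simp add: sum_subtractf sum_distrib_left)
  then have "q * (moment (Suc N) j - moment N j) = of_int z"
    unfolding unit_average_def sum_units_Suc[OF N] by (simp add: field_simps)
  then show ?thesis by simp
qed

lemma moment_trivial: "q ^ N * moment N j \<in> Z"
  by (auto simp: unit_average_def intro!: Z_sum Z_power Z_of_nat)

text \<open>
  For \<open>j \<ge> p - 1\<close> the step from \<open>N = 1\<close> to \<open>N = 2\<close> can cost a second factor \<open>p\<close>, because
  \<open>\<Sum>\<^sub>t t\<^sup>j\<close> over \<open>t < p\<close> need not vanish modulo \<open>p\<close>. The sharper bound is only needed for \<open>j \<le> 2\<close>.
\<close>
lemma moment_le_2:
  assumes "N > 0" "j \<le> 2"
  shows "q * moment N j \<in> Z"
  using assms(1)
proof (induction N rule: nat_induct_non_zero)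
  case 1
  then show ?case using moment_trivial[of 1 j] by simp
next
  case (Suc N)
  have "q * moment N j + q * (moment (Suc N) j - moment N j) \<in> Z"
    using moment_Suc_diff[of N j] Suc assms by (intro Z_add) auto
  then show ?case by (simp add: algebra_simps)
qed

text \<open>At N = 2 the trivial denominator is p^2, and all later increments have denominator at
  most \<open>p\<close>.\<close>

lemma moment_general:
  assumes "N > 0"
  shows "q ^ 2 * moment N j \<in> Z"
proof (cases "N = 1")
  case True
  then show ?thesis using Z_mult[OF Z_of_nat[of p] moment_trivial[of 1 j]] by (simp add: power2_eq_square mult_ac)
next
  case False
  then have "N \<ge> 2" using assms by simp
  then show ?thesis
  proof (induction N rule: dec_induct)
    case base
    then show ?case using moment_trivial[of 2 j] by simp
  next
    case (step N)
    have "q ^ 2 * moment N j + q * (q * (moment (Suc N) j - moment N j)) \<in> Z"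
      using moment_Suc_diff[of N j] step.hyps
      by (intro Z_add[OF step.IH Z_mult[OF Z_of_nat]]) auto
    then show ?case by (simp add: algebra_simps power2_eq_square)
  qed
qed

section \<open>The case where p - 1 divides n\<close>

text \<open>The average of (x^n - 1) / k over units. The upper limit \<open>K\<close> is separate
  from \<open>k\<close> so that expansions for two values of \<open>k\<close> can share one index
  range; binomials beyond \<open>k\<close> vanish.\<close>

definition expansion :: "nat \<Rightarrow> nat \<Rightarrow> nat \<Rightarrow> rat" where
  "expansion N k K = (\<Sum>j=1..K. of_nat ((k - 1) choose (j - 1)) / of_nat j * (q ^ j * moment N j))"

lemma q_minus_1: "q - 1 = of_nat (p - 1)" "q - 1 \<noteq> 0"
  using p_ge_5 by (auto simp: of_nat_diff)

lemma Z_divide_q_minus_1: "x \<in> Z \<Longrightarrow> x / (q - 1) \<in> Z"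
  unfolding q_minus_1 using p_ge_5 by (intro Z_divide_unit) (auto dest: dvd_imp_le)

lemma unit_average_power:
  assumes N: "N > 0" and k: "k > 0" "k \<le> K" and n: "n = (p - 1) * k"
  shows "(unit_average N (\<lambda>x. of_nat x ^ n) - (1 - 1 / q)) / of_nat n = expansion N k K / (q - 1)"
proof -
  have pow: "(of_nat x ^ n - 1 :: rat) = of_nat k * (\<Sum>j=1..K. of_nat ((k - 1) choose (j - 1)) / of_nat j * (q ^ j * of_nat (w x) ^ j))"
    if "x \<in> units N" for x
  proof -
    have "x ^ n = (p * w x + 1) ^ k"
      using that power_eq_fermat_quotient[of x] by (simp add: units_def n power_mult add.commute)
    then have "of_nat (x ^ n) = (of_nat ((p * w x + 1) ^ k) :: rat)" by simp
    then have "of_nat x ^ n = (q * of_nat (w x) + 1) ^ k" by (simp add: add.commute)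
    also have "\<dots> = (\<Sum>j\<le>k. of_nat (k choose j) * (q * of_nat (w x)) ^ j)"
      by (simp only: binomial_ring power_one mult_1_right)
    also have "{..k} = insert 0 {1..k}" by auto
    also have "(\<Sum>j\<in>insert 0 {1..k}. of_nat (k choose j) * (q * of_nat (w x)) ^ j) =
       1 + (\<Sum>j=1..k. of_nat (k choose j) * (q * of_nat (w x)) ^ j)" by simp
    also have "(\<Sum>j=1..k. of_nat (k choose j) * (q * of_nat (w x)) ^ j) =
       (\<Sum>j=1..K. of_nat (k choose j) * (q * of_nat (w x)) ^ j)"
      using k by (intro sum.mono_neutral_left) auto
    also have "\<dots> = of_nat k * (\<Sum>j=1..K. of_nat ((k - 1) choose (j - 1)) / of_nat j * (q ^ j * of_nat (w x) ^ j))"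
      unfolding sum_distrib_left
    proof (intro sum.cong refl)
      fix j assume "j \<in> {1..K}"
      then have "j > 0" by simp
      then have "of_nat j * of_nat (k choose j) = (of_nat k * of_nat ((k-1) choose (j-1)) :: rat)"
        using times_binomial_minus1_eq[of j k] by (metis of_nat_mult)
      with \<open>j > 0\<close> show "of_nat (k choose j) * (q * of_nat (w x)) ^ j =
        of_nat k * (of_nat ((k - 1) choose (j - 1)) / of_nat j * (q ^ j * of_nat (w x) ^ j))"
        by (simp add: field_simps)
    qed
    finally show ?thesis by simp
  qed
  have "unit_average N (\<lambda>x. of_nat x ^ n) - (1 - 1 / q) = unit_average N (\<lambda>x. of_nat x ^ n) - unit_average N (\<lambda>_. 1)"
    using unit_average_1[OF N] by simp
  also have "\<dots> = (\<Sum>x\<in>units N. of_nat x ^ n - 1) / q ^ N"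
    unfolding unit_average_def sum_subtractf by (simp add: diff_divide_distrib)
  also have "\<dots> = (\<Sum>x\<in>units N. of_nat k * (\<Sum>j=1..K. of_nat ((k - 1) choose (j - 1)) / of_nat j * (q ^ j * of_nat (w x) ^ j))) / q ^ N"
    using pow by simp
  also have "\<dots> = of_nat k * (\<Sum>j=1..K. of_nat ((k - 1) choose (j - 1)) / of_nat j * (q ^ j * (\<Sum>x\<in>units N. of_nat (w x) ^ j))) / q ^ N"
    unfolding sum_distrib_left by (subst sum.swap) simp
  also have "\<dots> = of_nat k * expansion N k K"
    unfolding expansion_def unit_average_def by (simp add: sum_divide_distrib sum_distrib_left)
  finally show ?thesis using k by (simp add: n q_minus_1)
qed

definition reduced_bernoulli :: "nat \<Rightarrow> rat" where
  "reduced_bernoulli n = (bernoulli n - (1 - 1 / q)) / of_nat n"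

text \<open>The limit of \<open>average_power_split\<close>: both averages tend to
  \<open>bernoulli n\<close>, and the multiples of \<open>p\<close> leave the term with
  \<open>q ^ (n - 1)\<close>.\<close>

lemma eventually_reduced_bernoulli:
  assumes k: "k > 0" "k \<le> K" and n: "n = (p - 1) * k"
  shows "\<forall>\<^sub>F N in sequentially. (reduced_bernoulli n -
     (expansion (Suc N) k K / (q - 1) + q ^ (n - 1) * bernoulli n / of_nat n)) / y \<in> Z"
proof -
  have n0: "n > 0" using k p_ge_5 by (simp add: n)
  let ?A = "\<lambda>N. average N (\<lambda>x. of_nat x ^ n)"
  have "\<forall>\<^sub>F N in sequentially. (?A (Suc N) - bernoulli n) / (of_nat n * y) \<in> Z"
    using sequentially_offset[OF eventually_average_power[of n "of_nat n * y"], of 1] by simp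
  then show ?thesis using eventually_average_power[of n "of_nat n * y"]
  proof eventually_elim
    case (elim N)
    have alg: "((B - r) / n' - ((A' - s * A - r) / n' + s * B / n')) / y = s * ((A - B) / (n' * y)) - (A' - B) / (n' * y)"
      for B r n' A' s A :: rat
      by (simp add: diff_divide_distrib add_divide_distrib algebra_simps)
    have eq: "expansion (Suc N) k K / (q - 1) = (?A (Suc N) - q ^ (n - 1) * ?A N - (1 - 1 / q)) / of_nat n"
      using unit_average_power[OF _ k n, of "Suc N"] average_power_split[OF n0, of N] by simp
    have "(reduced_bernoulli n - (expansion (Suc N) k K / (q - 1) + q ^ (n - 1) * bernoulli n / of_nat n)) / y
      = q ^ (n - 1) * ((?A N - bernoulli n) / (of_nat n * y)) - (?A (Suc N) - bernoulli n) / (of_nat n * y)"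
      unfolding eq reduced_bernoulli_def by (rule alg)
    also have "\<dots> \<in> Z" using elim by (intro Z_diff Z_mult Z_power Z_of_nat)
    finally show ?case .
  qed
qed

text \<open>One factor \<open>p\<close> (for j <= 2) or two (for j >= 3) pay for the moment; the
  remaining power of \<open>p\<close> absorbs the division by \<open>j\<close>.\<close>

lemma expansion_term_in_Z:
  assumes "N > 0" "j > 0"
  shows "(q ^ j * moment N j) / of_nat j \<in> Z"
proof (cases "j \<le> 2")
  case True
  have "q ^ j * moment N j / of_nat j = q ^ (j - 1) / of_nat j * (q * moment N j)"
    using assms by (simp add: power_eq_if)
  also have "\<dots> \<in> Z" using assms True by (intro Z_mult[OF Z_q_power_div moment_le_2]) auto
  finally show ?thesis .
next
  case False
  then have "j = (j - 2) + 2" by simp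
  then have "q ^ j = q ^ (j - 2) * q ^ 2" by (metis power_add)
  then have "q ^ j * moment N j / of_nat j = q ^ (j - 2) / of_nat j * (q ^ 2 * moment N j)" by simp
  also have "\<dots> \<in> Z" using assms False by (intro Z_mult[OF Z_q_power_div moment_general]) auto
  finally show ?thesis .
qed

text \<open>With the extra division by \<open>p\<close>, j = 2 leaves only one spare factor, which
  is where the sharper bound \<open>moment_le_2\<close> is essential; then i = 1. For j >= 3 the
  power p^(j-3) absorbs both \<open>i\<close> and \<open>j\<close>, since i + j <= 2j - 1 <= 4(j-3)
  + 5.\<close>

lemma expansion_difference_term_in_Z:
  assumes "N > 0" "0 < i" "i < j"
  shows "(q ^ j * moment N j) / (of_nat i * of_nat j * q) \<in> Z"
proof (cases "j = 2")
  case True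
  with assms have "i = 1" by simp
  with True have "(q ^ j * moment N j) / (of_nat i * of_nat j * q) = q ^ 0 / of_nat 2 * (q * moment N j)"
    unfolding True \<open>i = 1\<close> by (simp add: power2_eq_square)
  also have "\<dots> \<in> Z" using assms True by (intro Z_mult[OF Z_q_power_div moment_le_2]) auto
  finally show ?thesis .
next
  case False
  then have "j \<ge> 3" using assms by simp
  then have "q ^ j = q ^ (j - 3) * q ^ 3" by (simp flip: power_add)
  also have "q ^ 3 = q * q ^ 2" by (simp add: power3_eq_cube power2_eq_square)
  finally have "(q ^ j * moment N j) / (of_nat i * of_nat j * q) = q ^ (j - 3) / (of_nat i * of_nat j) * (q ^ 2 * moment N j)"
    by simp
  also have "\<dots> \<in> Z" using assms \<open>j \<ge> 3\<close>
    by (intro Z_mult[OF Z_q_power_div_2 moment_general]) auto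
  finally show ?thesis .
qed

lemma expansion_in_Z: "N > 0 \<Longrightarrow> expansion N k K \<in> Z"
  unfolding expansion_def using Z_mult[OF Z_of_nat expansion_term_in_Z] by (intro Z_sum) auto

text \<open>The term j = 1 has binomial 1 for every \<open>k\<close> and cancels. In the others
  \<open>binomial_difference\<close> produces the factor \<open>d\<close> at the price of a
  denominator \<open>i < j\<close>.\<close>

lemma expansion_difference_in_Z:
  assumes "N > 0" "k > 0" "d > 0"
  shows "(expansion N (k + d) K - expansion N k K) / (q * of_nat d) \<in> Z"
proof -
  have "(expansion N (k + d) K - expansion N k K) / (q * of_nat d) =
     (\<Sum>j=1..K. (of_nat ((k + d - 1) choose (j - 1)) - of_nat ((k - 1) choose (j - 1))) / of_nat j * (q ^ j * moment N j) / (q * of_nat d))"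
    by (simp add: expansion_def sum_subtractf left_diff_distrib diff_divide_distrib sum_divide_distrib)
  also have "\<dots> \<in> Z"
  proof (intro Z_sum)
    fix j assume "j \<in> {1..K}"
    show "(of_nat ((k + d - 1) choose (j - 1)) - of_nat ((k - 1) choose (j - 1))) / of_nat j * (q ^ j * moment N j) / (q * of_nat d) \<in> Z"
    proof (cases "j = 1")
      case False
      with \<open>j \<in> {1..K}\<close> have j: "j \<ge> 2" by simp
      have kd: "k + d - 1 = (k - 1) + d" using assms by simp
      have "(of_nat ((k + d - 1) choose (j - 1)) - of_nat ((k - 1) choose (j - 1))) / of_nat j * (q ^ j * moment N j) / (q * of_nat d)
        = (\<Sum>i=1..j-1. of_nat ((d - 1) choose (i - 1)) * of_nat ((k - 1) choose (j - 1 - i)) * ((q ^ j * moment N j) / (of_nat i * of_nat j * q)))"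
        unfolding kd using j assms by (subst binomial_difference) (auto simp: sum_distrib_left sum_divide_distrib mult_ac)
      also have "\<dots> \<in> Z"
        using j assms by (intro Z_sum Z_mult[OF Z_mult[OF Z_of_nat Z_of_nat] expansion_difference_term_in_Z]) auto
      finally show ?thesis .
    qed simp
  qed
  finally show ?thesis .
qed

lemma q_power_bernoulli_in_Z:
  assumes "n \<ge> 2" "q ^ (n - 2) / y \<in> Z"
  shows "q ^ (n - 1) * bernoulli n / y \<in> Z"
proof -
  have "q ^ (n - 1) = q ^ (n - 2) * q" using assms(1) by (auto simp: le_iff_add numeral_2_eq_2)
  then have "q ^ (n - 1) * bernoulli n / y = (q ^ (n - 2) / y) * (q * bernoulli n)" by simp
  also have "\<dots> \<in> Z" by (rule Z_mult[OF assms(2) p_bernoulli])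
  finally show ?thesis .
qed

lemma reduced_bernoulli_in_Z:
  assumes "(p - 1) dvd n" "n > 0"
  shows "reduced_bernoulli n \<in> Z"
proof -
  obtain k where n: "n = (p - 1) * k" using assms by blast
  have k: "k > 0" using assms n by (cases k) auto
  have "n \<ge> 4" using k p_ge_5 dvd_imp_le[OF assms] by simp
  obtain N where "(reduced_bernoulli n - (expansion (Suc N) k k / (q - 1) + q ^ (n - 1) * bernoulli n / of_nat n)) / 1 \<in> Z"
    using eventually_happens'[OF sequentially_bot eventually_reduced_bernoulli[OF k order.refl n]] by blast
  moreover have "expansion (Suc N) k k / (q - 1) + q ^ (n - 1) * bernoulli n / of_nat n \<in> Z"
    using \<open>n \<ge> 4\<close>
    by (intro Z_add Z_divide_q_minus_1 expansion_in_Z q_power_bernoulli_in_Z Z_q_power_div) auto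
  ultimately show ?thesis using Z_add by fastforce
qed

text \<open>Since n - m = (p - 1) d, the parameters are k + d and k, and the expansions differ by a
  multiple of p d. The contributions of the multiples of \<open>p\<close> are integral even after
  division by p d, each on its own.\<close>

lemma reduced_bernoulli_cong:
  assumes n: "n = p * d + 2" "(p - 1) dvd n" and m: "m = d + 2" "(p - 1) dvd m" and d: "d \<ge> 2"
  shows "(reduced_bernoulli n - reduced_bernoulli m) / (q * of_nat d) \<in> Z"
proof -
  obtain k where mk: "m = (p - 1) * k" using m by blast
  have k: "k > 0" using mk m by (cases k) auto
  have nk: "n = (p - 1) * (k + d)"
    using mk n m p_ge_5 by (cases p) (auto simp: algebra_simps)
  let ?y = "q * of_nat d" and ?K = "k + d"
  let ?R = "\<lambda>n. q ^ (n - 1) * bernoulli n / of_nat n"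
  obtain N where N:
    "(reduced_bernoulli n - (expansion (Suc N) (k + d) ?K / (q - 1) + ?R n)) / ?y \<in> Z"
    "(reduced_bernoulli m - (expansion (Suc N) k ?K / (q - 1) + ?R m)) / ?y \<in> Z"
    using eventually_happens'[OF sequentially_bot eventually_conj[OF
      eventually_reduced_bernoulli[OF _ _ nk, of ?K ?y] eventually_reduced_bernoulli[OF k _ mk, of ?K ?y]]] k by auto
  have Rn: "q ^ (n - 1) * bernoulli n / (of_nat n * ?y) \<in> Z"
  proof (rule q_power_bernoulli_in_Z)
    have "d \<le> p * d" using p_ge_5 by simp
    then have "d \<le> 4 * (p * d - 1) + 4" using d by linarith
    \<comment> \<open>As n is 2 modulo \<open>p\<close>, only \<open>d\<close> can contribute to the
      denominator.\<close>
    have "\<not> p dvd n"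
      using n(1) p_ge_5 by (auto simp: dvd_add_right_iff simp del: add_2_eq_Suc' dest: dvd_imp_le)
    moreover have "q ^ (p * d - 1) / of_nat d \<in> Z"
      using d by (intro Z_q_power_div \<open>d \<le> 4 * (p * d - 1) + 4\<close>) auto
    ultimately have "q ^ (p * d - 1) / of_nat d / of_nat n \<in> Z" by (rule Z_divide_unit[rotated])
    moreover have "q ^ (p * d) = q ^ (p * d - 1) * q"
      using d by (simp flip: power_Suc2)
    ultimately show "q ^ (n - 2) / (of_nat n * ?y) \<in> Z" using n by (simp add: mult_ac)
  qed (use n in auto)
  have Rm: "q ^ (m - 1) * bernoulli m / (of_nat m * ?y) \<in> Z"
  proof (rule q_power_bernoulli_in_Z)
    \<comment> \<open>In contrast to \<open>n\<close>, the number m = d + 2 may be divisible by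
      \<open>p\<close>, so both denominators are bounded together.\<close>
    have "q ^ (d - 1) / (of_nat m * of_nat d) \<in> Z"
      using d m by (intro Z_q_power_div_2) auto
    moreover have "q ^ d = q ^ (d - 1) * q"
      using d by (simp flip: power_Suc2)
    ultimately show "q ^ (m - 2) / (of_nat m * ?y) \<in> Z" using m by (simp add: mult_ac)
  qed (use m in auto)
  have "(reduced_bernoulli n - (expansion (Suc N) (k + d) ?K / (q - 1) + ?R n)) / ?y -
     (reduced_bernoulli m - (expansion (Suc N) k ?K / (q - 1) + ?R m)) / ?y +
     (expansion (Suc N) (k + d) ?K - expansion (Suc N) k ?K) / ?y / (q - 1) +
     q ^ (n - 1) * bernoulli n / (of_nat n * ?y) - q ^ (m - 1) * bernoulli m / (of_nat m * ?y) \<in> Z"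
    using N Rn Rm k d by (intro Z_add Z_diff Z_divide_q_minus_1 expansion_difference_in_Z) auto
  also have "(reduced_bernoulli n - (expansion (Suc N) (k + d) ?K / (q - 1) + ?R n)) / ?y -
     (reduced_bernoulli m - (expansion (Suc N) k ?K / (q - 1) + ?R m)) / ?y +
     (expansion (Suc N) (k + d) ?K - expansion (Suc N) k ?K) / ?y / (q - 1) +
     q ^ (n - 1) * bernoulli n / (of_nat n * ?y) - q ^ (m - 1) * bernoulli m / (of_nat m * ?y) =
     (reduced_bernoulli n - reduced_bernoulli m) / ?y"
    by (simp add: diff_divide_distrib add_divide_distrib mult_ac)
  finally show ?thesis .
qed

text \<open>Kummer's congruence modulo p^(s+1), where p^s exactly divides \<open>d\<close>. For
  units, n - m = (p - 1) d is a multiple of the totient of p^(s+1); for multiples of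
  \<open>p\<close> both powers vanish, because the exponents exceed \<open>s\<close>.\<close>

lemma bernoulli_divide_cong:
  assumes n: "n = p * d + 2" "\<not> (p - 1) dvd n" and m: "m = d + 2" "\<not> (p - 1) dvd m" and d: "d > 0"
  shows "(bernoulli n / of_nat n - bernoulli m / of_nat m) / (q * of_nat d) \<in> Z"
proof -
  obtain s e where e: "d = p ^ s * e" "\<not> p dvd e" "4 * s + 1 \<le> d" using valuation_bound[OF d] .
  have "(bernoulli n / of_nat n - bernoulli m / of_nat m) / q ^ Suc s \<in> Z"
  proof (rule kummer_cong)
    fix y
    show "[y ^ (n - 1) = y ^ (m - 1)] (mod p ^ Suc s)"
    proof (cases "p dvd y")
      case True
      have dvd: "p ^ Suc s dvd y ^ r" if "r \<ge> Suc s" for r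
        using that True by (meson dvd_trans dvd_power_same le_imp_power_dvd)
      have "d \<le> p * d" using p_ge_5 by simp
      moreover have "Suc s \<le> d" using e(3) d by linarith
      ultimately have "n - 1 \<ge> Suc s" "m - 1 \<ge> Suc s" unfolding n(1) m(1) by linarith+
      then show ?thesis using dvd by (simp add: cong_def mod_eq_0_iff_dvd del: power_Suc)
    next
      case False
      then have "coprime y (p ^ Suc s)"
        using prime_imp_coprime[OF prime_p False] by (simp add: coprime_commute)
      from euler_theorem[OF this] have "[y ^ totient (p ^ Suc s) = 1] (mod p ^ Suc s)" .
      then have "[y ^ (p ^ s * (p - 1)) = 1] (mod p ^ Suc s)"
        using totient_prime_power_Suc[OF prime_p] by simp
      from cong_pow[OF this, of e] have "[y ^ ((p - 1) * d) = 1] (mod p ^ Suc s)"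
        by (simp add: e mult_ac flip: power_mult)
      from cong_mult[OF cong_refl[of "y ^ (m - 1)"] this]
      have "[y ^ (m - 1 + (p - 1) * d) = y ^ (m - 1)] (mod p ^ Suc s)"
        by (simp add: power_add)
      moreover have "m - 1 + (p - 1) * d = n - 1" using n m p_ge_5
        by (cases p) auto
      ultimately show ?thesis by simp
    qed
  qed (use n m in auto)
  then have "(bernoulli n / of_nat n - bernoulli m / of_nat m) / q ^ Suc s / of_nat e \<in> Z"
    using e by (intro Z_divide_unit)
  then show ?thesis using e by (simp add: mult_ac)
qed

section \<open>From Bernoulli numbers to zeta quotients\<close>

text \<open>Equal to zeta(1 - n) / (2 - n): the sign of the zeta value cancels against that of the
  denominator.\<close>

abbreviation zeta_quotient :: "nat \<Rightarrow> rat" where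
  "zeta_quotient n \<equiv> bernoulli n / of_nat n / (of_nat n - 2)"

abbreviation correction :: "nat \<Rightarrow> rat" where
  "correction n \<equiv> (q - 1)^2 / (of_nat n * (q * (of_nat n + 2 * q - 2)))"

lemma zeta_quotient_difference_correction_in_Z:
  assumes n: "n = p * d + 2" "(p - 1) dvd n" and d: "d \<ge> 2"
  shows "zeta_quotient n - 1 / q * zeta_quotient (d + 2) + correction n \<in> Z"
proof -
  have "n = (p - 1) * d + (d + 2)" using n p_ge_5 by (cases p) auto
  then have "(p - 1) dvd d + 2" using n by (metis dvd_add_right_iff dvd_triv_left)
  then have *: "(reduced_bernoulli n - reduced_bernoulli (d + 2)) / (q * of_nat d) \<in> Z"
    by (intro reduced_bernoulli_cong n d refl)
  have alg: "B / N / (N - 2) - 1 / Q * (C / M / (M - 2)) + (Q - 1)^2 / (N * (Q * (N + 2 * Q - 2))) =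
      ((B - (1 - 1 / Q)) / N - (C - (1 - 1 / Q)) / M) / (Q * D)"
    if "N = Q * D + 2" "M = D + 2" "Q \<noteq> 0" "D \<noteq> 0" "N \<noteq> 0" "M \<noteq> 0" for B C N M D Q :: rat
  proof -
    \<comment> \<open>The correction factors because N + 2Q - 2 = Q M; with N - M = (Q - 1) D it
      becomes the difference of (1 - 1/Q) / M and (1 - 1/Q) / N, divided by Q D.\<close>
    have "N + 2 * Q - 2 = Q * M" "N - 2 = Q * D" "M - 2 = D" using that by (simp_all add: algebra_simps)
    moreover have "(Q - 1)^2 / (N * (Q * (Q * M))) = (1 - 1 / Q) * (N - M) / (N * M * (Q * D))"
      using that by (simp add: divide_simps) (simp add: power2_eq_square algebra_simps)
    moreover have "(1 - 1 / Q) * (N - M) / (N * M * (Q * D)) = (- (1 - 1 / Q) / N + (1 - 1 / Q) / M) / (Q * D)"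
      using that(3-6) by (simp add: divide_simps) (simp add: algebra_simps)
    ultimately show ?thesis by (simp add: diff_divide_distrib add_divide_distrib)
  qed
  have "zeta_quotient n - 1 / q * zeta_quotient (d + 2) + correction n =
      (reduced_bernoulli n - reduced_bernoulli (d + 2)) / (q * of_nat d)"
    unfolding reduced_bernoulli_def by (rule alg) (use d n in \<open>auto simp flip: of_nat_mult of_nat_Suc\<close>)
  with * show ?thesis by (simp only:)
qed

lemma zeta_quotient_difference_in_Z:
  assumes n: "n = p * d + 2" "\<not> (p - 1) dvd n" and d: "d > 0"
  shows "zeta_quotient n - 1 / q * zeta_quotient (d + 2) \<in> Z"
proof -
  have "n = (p - 1) * d + (d + 2)" using n p_ge_5 by (cases p) auto
  then have "\<not> (p - 1) dvd d + 2" using n by (metis dvd_add_right_iff dvd_triv_left)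
  then have "(bernoulli n / of_nat n - bernoulli (d + 2) / of_nat (d + 2)) / (q * of_nat d) \<in> Z"
    by (intro bernoulli_divide_cong n d refl)
  then show ?thesis using n by (simp add: diff_divide_distrib mult_ac)
qed

lemma Z_divide_minus_2:
  assumes "\<not> p dvd n - 2" "n \<ge> 2"
  shows "x \<in> Z \<Longrightarrow> x / (of_nat n - 2) \<in> Z"
  using Z_divide_unit[of x "n - 2"] assms by (simp add: of_nat_diff)

text \<open>Adding the correction to (1 - 1/p) / (n (n - 2)) cancels both \<open>p\<close> and
  \<open>n\<close> from the denominator and gives (p - 1) / ((n + 2p - 2)(n - 2)). This is integral,
  since n + 2p - 2 is congruent to n - 2 modulo \<open>p\<close>.\<close>

lemma zeta_quotient_correction_in_Z:
  assumes n: "(p - 1) dvd n" "\<not> p dvd n - 2" "n > 2"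
  shows "zeta_quotient n + correction n \<in> Z"
proof -
  have "\<not> p dvd n - 2 + 2 * p" using n(2) by (subst dvd_add_left_iff) auto
  then have "(q - 1) / of_nat (n - 2 + 2 * p) / (of_nat n - 2) \<in> Z"
    using n by (intro Z_divide_minus_2 Z_divide_unit Z_diff Z_of_nat Z_1) auto
  then have "reduced_bernoulli n / (of_nat n - 2) + (q - 1) / of_nat (n - 2 + 2 * p) / (of_nat n - 2) \<in> Z"
    using n by (intro Z_add[OF Z_divide_minus_2[OF _ _ reduced_bernoulli_in_Z]]) auto
  moreover have "of_nat (n - 2 + 2 * p) = of_nat n + 2 * q - 2"
    using n by (simp add: of_nat_diff)
  moreover have "(B - (1 - 1 / Q)) / N / (N - 2) + (Q - 1) / (N + 2 * Q - 2) / (N - 2) =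
      B / N / (N - 2) + (Q - 1)^2 / (N * (Q * (N + 2 * Q - 2)))"
    if "Q \<noteq> 0" "N \<noteq> 0" "N - 2 \<noteq> 0" "N + 2 * Q - 2 \<noteq> 0" for B N Q :: rat
    using that by (simp add: divide_simps) (simp add: power2_eq_square algebra_simps)
  moreover have "of_nat n + 2 * q - 2 \<noteq> 0"
    using calculation(2) n by (metis add_is_0 diff_is_0_eq not_le of_nat_eq_0_iff)
  moreover have "of_nat n - 2 \<noteq> (0 :: rat)" using n by (metis diff_is_0_eq not_le of_nat_diff of_nat_eq_0_iff of_nat_numeral order_less_imp_le)
  ultimately show ?thesis using n by (simp add: reduced_bernoulli_def)
qed

lemma zeta_quotient_in_Z:
  assumes "\<not> (p - 1) dvd n" "\<not> p dvd n - 2" "n \<ge> 2"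
  shows "zeta_quotient n \<in> Z"
  using assms by (intro Z_divide_minus_2 bernoulli_divide_in_Z)

end

section \<open>Transfer to the complex zeta values\<close>

lemma cong_mod_localizationI: "x = of_rat r \<Longrightarrow> r \<in> localization_at p \<Longrightarrow> cong_mod_localization x 0 p"
  by (simp add: cong_mod_localization_def)

theorem theorem6p11:
  fixes p u :: int
  assumes "prime p" and "p \<ge> 5" and "u \<ge> 2"
  shows
    "((p - 1) dvd 2 * u \<and> p dvd 2 * u - 2 \<longrightarrow>
        (let v = (of_int u - 1) / of_int p + 1 in
         cong_mod_localization
           (riemann_zeta (1 - 2 * of_int u) / (2 - 2 * of_int u)
            - 1 / of_int p * (riemann_zeta (1 - 2 * v) / (2 - 2 * v))
            + (of_int p - 1)^2 / (2 * of_int u * (of_int p * (2 * of_int u + 2 * of_int p - 2))))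
           0 p)) \<and>
     (\<not> (p - 1) dvd 2 * u \<and> p dvd 2 * u - 2 \<longrightarrow>
        (let v = (of_int u - 1) / of_int p + 1 in
         cong_mod_localization
           (riemann_zeta (1 - 2 * of_int u) / (2 - 2 * of_int u)
            - 1 / of_int p * (riemann_zeta (1 - 2 * v) / (2 - 2 * v)))
           0 p)) \<and>
     ((p - 1) dvd 2 * u \<and> \<not> p dvd 2 * u - 2 \<longrightarrow>
        cong_mod_localization
          (riemann_zeta (1 - 2 * of_int u) / (2 - 2 * of_int u)
           + (of_int p - 1)^2 / (2 * of_int u * (of_int p * (2 * of_int u + 2 * of_int p - 2))))
          0 p) \<and>
     (\<not> (p - 1) dvd 2 * u \<and> \<not> p dvd 2 * u - 2 \<longrightarrow>
        cong_mod_localization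
          (riemann_zeta (1 - 2 * of_int u) / (2 - 2 * of_int u))
          0 p)"
proof -
  define P n where "P = nat p" and "n = nat (2 * u)"
  have p: "p = int P" and u: "2 * u = int n" and n4: "n \<ge> 4"
    using assms by (auto simp: P_def n_def)
  interpret prime_ge_5 P
    using assms p by unfold_locales auto
  have n_eq: "2 * of_int u = (of_nat n :: complex)"
    using arg_cong[OF u, of "of_int :: int \<Rightarrow> complex"] by simp
  have P_eq: "of_int p = (of_nat P :: complex)" by (simp add: p)
  have dvd1: "(p - 1) dvd 2 * u \<longleftrightarrow> (P - 1) dvd n"
    using p_ge_5 by (simp add: p u flip: int_dvd_int_iff add: of_nat_diff)
  have dvd2: "p dvd 2 * u - 2 \<longleftrightarrow> P dvd n - 2"
    using n4 by (simp add: p u flip: int_dvd_int_iff add: of_nat_diff)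
  have zeta: "riemann_zeta (1 - of_nat k) / (2 - of_nat k) = of_rat (zeta_quotient k)" if "k > 2" for k
  proof -
    have "2 - of_nat k = - (of_rat (of_nat k - 2) :: complex)" by (simp add: of_rat_diff)
    then show ?thesis using that by (simp add: riemann_zeta_negative of_rat_divide of_rat_mult)
  qed
  have zeta_n: "riemann_zeta (1 - of_nat n) / (2 - of_nat n) = of_rat (zeta_quotient n)"
    by (rule zeta) (use n4 in simp)
  have zeta_diff: "riemann_zeta (1 - of_nat n) / (2 - of_nat n) - 1 / of_int p * (riemann_zeta (1 - of_nat (d + 2)) / (2 - of_nat (d + 2))) =
      of_rat (zeta_quotient n - 1 / q * zeta_quotient (d + 2))" if "d \<ge> 2" for d
    using n4 that zeta[of n] zeta[of "d + 2"] by (simp only: of_rat_diff of_rat_mult P_eq) (simp add: of_rat_divide)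
  have corr: "(of_int p - 1)^2 / (of_nat n * (of_int p * (of_nat n + 2 * of_int p - 2))) =
     (of_rat (correction n) :: complex)"
    unfolding P_eq by (simp add: of_rat_divide of_rat_mult of_rat_add of_rat_diff of_rat_power)
  have v: "\<exists>d. n = P * d + 2 \<and> d \<ge> 2 \<and> 2 * ((of_int u - 1) / of_int p + 1) = (of_nat (d + 2) :: complex)"
    if "P dvd n - 2"
  proof -
    from that obtain d where "n - 2 = P * d" by blast
    then have d: "n = P * d + 2" using n4 by simp
    \<comment> \<open>Parity rules out d = 1: \<open>n\<close> is even and \<open>P\<close> odd, so
      \<open>d\<close> is even and positive.\<close>
    have "even n" using u by (metis dvd_triv_left even_of_nat)
    moreover have "odd P" using prime_p p_ge_5 by (intro prime_odd_nat) auto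
    ultimately have "even d" using d by simp
    moreover have "d > 0" using d n4 by (cases d) auto
    ultimately have "d \<ge> 2" by (auto elim!: evenE)
    moreover have "2 * ((of_int u - 1) / of_int p + 1) = (2 * of_int u - 2) / of_int p + (2 :: complex)"
      by (simp add: diff_divide_distrib)
    then have "2 * ((of_int u - 1) / of_int p + 1) = (of_nat (d + 2) :: complex)"
      unfolding n_eq P_eq by (simp add: d)
    ultimately show ?thesis using d by blast
  qed
  show ?thesis
  proof (intro conjI impI; (elim conjE)?)
    assume *: "(p - 1) dvd 2 * u" "p dvd 2 * u - 2"
    then obtain d where d: "n = P * d + 2" "d \<ge> 2"
      and v: "2 * ((of_int u - 1) / of_int p + 1) = (of_nat (d + 2) :: complex)"
      using v dvd2 by blast
    have "zeta_quotient n - 1 / q * zeta_quotient (d + 2) + correction n \<in> localization_at p"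
      unfolding p using d * dvd1 by (intro zeta_quotient_difference_correction_in_Z) auto
    then show "let v = (of_int u - 1) / of_int p + 1 in
         cong_mod_localization
           (riemann_zeta (1 - 2 * of_int u) / (2 - 2 * of_int u)
            - 1 / of_int p * (riemann_zeta (1 - 2 * v) / (2 - 2 * v))
            + (of_int p - 1)^2 / (2 * of_int u * (of_int p * (2 * of_int u + 2 * of_int p - 2))))
           0 p"
      unfolding Let_def corr v n_eq zeta_diff[OF d(2)] of_rat_add[symmetric]
      by (rule cong_mod_localizationI[OF refl])
  next
    assume *: "\<not> (p - 1) dvd 2 * u" "p dvd 2 * u - 2"
    then obtain d where d: "n = P * d + 2" "d \<ge> 2"
      and v: "2 * ((of_int u - 1) / of_int p + 1) = (of_nat (d + 2) :: complex)"
      using v dvd2 by blast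
    have "zeta_quotient n - 1 / q * zeta_quotient (d + 2) \<in> localization_at p"
      unfolding p using d * dvd1 by (intro zeta_quotient_difference_in_Z) auto
    then show "let v = (of_int u - 1) / of_int p + 1 in
         cong_mod_localization
           (riemann_zeta (1 - 2 * of_int u) / (2 - 2 * of_int u)
            - 1 / of_int p * (riemann_zeta (1 - 2 * v) / (2 - 2 * v)))
           0 p"
      unfolding Let_def v n_eq zeta_diff[OF d(2)] by (rule cong_mod_localizationI[OF refl])
  next
    assume "(p - 1) dvd 2 * u" "\<not> p dvd 2 * u - 2"
    then have "zeta_quotient n + correction n \<in> localization_at p"
      unfolding p using dvd1 dvd2 n4 by (intro zeta_quotient_correction_in_Z) (auto simp: p)
    then show "cong_mod_localization
          (riemann_zeta (1 - 2 * of_int u) / (2 - 2 * of_int u)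
           + (of_int p - 1)^2 / (2 * of_int u * (of_int p * (2 * of_int u + 2 * of_int p - 2))))
          0 p"
      unfolding n_eq zeta_n corr of_rat_add[symmetric] by (rule cong_mod_localizationI[OF refl])
  next
    assume "\<not> (p - 1) dvd 2 * u" "\<not> p dvd 2 * u - 2"
    then have "zeta_quotient n \<in> localization_at p"
      unfolding p using dvd1 dvd2 n4 by (intro zeta_quotient_in_Z) (auto simp: p)
    then show "cong_mod_localization (riemann_zeta (1 - 2 * of_int u) / (2 - 2 * of_int u)) 0 p"
      unfolding n_eq zeta_n by (rule cong_mod_localizationI[OF refl])
  qed
qed

end
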